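(* In the diffusion setting described in the context, for every $0<c<1$, the pseudometrics $\ell^c$ and $\overline{d}^c$ on $E$ are equal.
   Context: Setting (diffusion). Let $E$ be a locally compact Hausdorff space with a countable base, with its Borel $\sigma$-algebra; $E$ is Polish and $\Delta$ is a fixed 1-bounded metric generating its topology $\mathcal{O}$. Let $(\hat P_t)_{t\ge 0}$ be an honest Feller–Dynkin semigroup on $C_0(E)$ with associated Markov (probability) kernels $P_t(x,\cdot)$. It is assumed to be a diffusion: the trajectory space is $\Omega=\{\omega:[0,\infty)\to E \text{ continuous}\}$ with the $\sigma$-algebra generated by evaluations and the topology generated by the uniform metric $U(\Delta)(\omega,\omega')=\sup_{t\ge0}\Delta(\omega(t),\omega'(t))$ (treated as Polish); for each $x\in E$, $\mathbb{P}^x$ is the law on $\Omega$ of the process started at $x$; and $x\mapsto\mathbb{P}^x$ is weakly continuous. A continuous observable $obs:E\to[0,1]$ is given. Optimal transport: $W(c)(\mu,\nu)=\min_{\gamma\in\Gamma(\mu,\nu)}\int c\,\mathrm{d}\gamma$ over couplings, for lower semi-continuous cost $c$ with values in $[0,1]$ vanishing on the diagonal. For a 1-bounded lower semi-continuous pseudometric $m$ on $E$: $U_c(m)(\omega,\omega')=\sup_{t\ge0}c^tm(\omega(t),\omega'(t))$, $\mathcal{G}_c(m)(x,y)=W(U_c(m))(\mathbb{P}^x,\mathbb{P}^y)$. $d^c_0(x,y)=|obs(x)-obs(y)|$, $d^c_{n+1}=\mathcal{G}_c(d^c_n)$ for $n\ge0$, $\overline{d}^c=\sup_nd^c_n$.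 Logic: $f\in\mathcal{L}_\sigma::= q\mid obs\mid 1-f\mid \int g$ and $g\in\mathcal{L}_\tau::= f\circ ev_t\mid \min\{g_1,g_2\}\mid\max\{g_1,g_2\}\mid g\ominus q\mid g\oplus q$, with $q\in\mathbb{Q}\cap[0,1]$, $t\in\mathbb{Q}_{\ge0}$. Interpretation (for the fixed $c$): $\mathcal{L}_\sigma$ as functions $E\to[0,1]$ with $q(x)=q$, $obs(x)$, $(1-f)(x)=1-f(x)$, $(\int g)(x)=\int g\,\mathrm{d}\mathbb{P}^x$; $\mathcal{L}_\tau$ as functions $\Omega\to[0,1]$ with $(f\circ ev_t)(\omega)=c^tf(\omega(t))$, pointwise min/max, $(g\ominus q)(\omega)=\max\{0,g(\omega)-q\}$, $(g\oplus q)(\omega)=\min\{1,g(\omega)+q\}$. Define $\ell^c(x,y)=\sup_{f\in\mathcal{L}_\sigma}|f(x)-f(y)|$. *)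

theory Defs
  imports "HOL-Probability.Probability"
begin

section \<open>Trajectories\<close>

text \<open>A trajectory is a continuous map on \<open>[0,\<infinity>)\<close>, represented by a total function that is
  \<open>undefined\<close> at negative times, so that equality of representatives is equality of trajectories.\<close>

definition trajectories :: "(real \<Rightarrow> 'a::topological_space) set" where
  "trajectories = {\<omega> \<in> extensional {0..}. continuous_on {0..} \<omega>}"

definition traj_algebra :: "(real \<Rightarrow> 'a::topological_space) measure" where
  "traj_algebra = sigma trajectories {{\<omega> \<in> trajectories. \<omega> t \<in> A} |t A. 0 \<le> t \<and> A \<in> sets borel}"

definition unif_dist :: "('a \<Rightarrow> 'a \<Rightarrow> real) \<Rightarrow> (real \<Rightarrow> 'a) \<Rightarrow> (real \<Rightarrow> 'a) \<Rightarrow> real" where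
  "unif_dist m \<omega> \<omega>' = (SUP t\<in>{0..}. m (\<omega> t) (\<omega>' t))"

definition disc_unif_dist ::
    "real \<Rightarrow> ('a \<Rightarrow> 'a \<Rightarrow> real) \<Rightarrow> (real \<Rightarrow> 'a) \<Rightarrow> (real \<Rightarrow> 'a) \<Rightarrow> real" where
  "disc_unif_dist c m \<omega> \<omega>' = (SUP t\<in>{0..}. c powr t * m (\<omega> t) (\<omega>' t))"

definition traj_topology :: "('a::topological_space \<Rightarrow> 'a \<Rightarrow> real) \<Rightarrow> (real \<Rightarrow> 'a) topology" where
  "traj_topology \<Delta> = Metric_space.mtopology trajectories (unif_dist \<Delta>)"

lemma Metric_space_trajectories:
  fixes \<Delta> :: "'a::topological_space \<Rightarrow> 'a \<Rightarrow> real"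
  assumes "Metric_space UNIV \<Delta>" and le1: "\<And>x y. \<Delta> x y \<le> 1"
  shows "Metric_space trajectories (unif_dist \<Delta>)"
proof -
  interpret D: Metric_space UNIV \<Delta> by fact
  have bdd: "bdd_above ((\<lambda>t. \<Delta> (u t) (v t)) ` {0..})" for u v :: "real \<Rightarrow> 'a"
    by (rule bdd_aboveI2[where M = 1]) (rule le1)
  have upper: "\<Delta> (u t) (v t) \<le> unif_dist \<Delta> u v" if "0 \<le> t" for u v t
    unfolding unif_dist_def by (rule cSUP_upper[OF _ bdd]) (use that in simp)
  show ?thesis
  proof
    show "0 \<le> unif_dist \<Delta> u v" for u v
      using upper[of 0 u v] D.nonneg[of "u 0" "v 0"] by linarith
    show "unif_dist \<Delta> u v = unif_dist \<Delta> v u" for u v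
      by (simp add: unif_dist_def D.commute)
    show "unif_dist \<Delta> u v = 0 \<longleftrightarrow> u = v" if "u \<in> trajectories" "v \<in> trajectories" for u v
    proof
      assume 0: "unif_dist \<Delta> u v = 0"
      have "u t = v t" if "0 \<le> t" for t
        using upper[OF that, of u v] D.nonneg[of "u t" "v t"] 0 D.zero[of "u t" "v t"] by simp
      then show "u = v"
        using that unfolding trajectories_def by (auto intro: extensionalityI)
    qed (simp add: unif_dist_def)
    show "unif_dist \<Delta> u w \<le> unif_dist \<Delta> u v + unif_dist \<Delta> v w" for u v w
      unfolding unif_dist_def[of _ u w]
    proof (rule cSUP_least)
      fix t :: real assume "t \<in> {0..}"
      then show "\<Delta> (u t) (w t) \<le> unif_dist \<Delta> u v + unif_dist \<Delta> v w"
        using upper[of t u v] upper[of t v w] D.triangle[of "u t" "v t" "w t"] by simp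
    qed simp
  qed
qed


section \<open>Honest Feller--Dynkin semigroups and diffusions\<close>

definition C0 :: "('a::topological_space, real) bcontfun set" where
  "C0 = {f. \<forall>\<epsilon>>0. \<exists>K. compact K \<and> (\<forall>x. x \<notin> K \<longrightarrow> \<bar>apply_bcontfun f x\<bar> < \<epsilon>)}"

locale feller_dynkin =
  fixes Phat :: "real \<Rightarrow> ('a::topological_space, real) bcontfun \<Rightarrow> ('a, real) bcontfun"
  assumes C0_invariant: "0 \<le> t \<Longrightarrow> f \<in> C0 \<Longrightarrow> Phat t f \<in> C0"
    and linear_add: "0 \<le> t \<Longrightarrow> f \<in> C0 \<Longrightarrow> g \<in> C0 \<Longrightarrow> Phat t (f + g) = Phat t f + Phat t g"
    and linear_scale: "0 \<le> t \<Longrightarrow> f \<in> C0 \<Longrightarrow> Phat t (a *\<^sub>R f) = a *\<^sub>R Phat t f"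
    and identity: "f \<in> C0 \<Longrightarrow> Phat 0 f = f"
    and semigroup: "0 \<le> s \<Longrightarrow> 0 \<le> t \<Longrightarrow> f \<in> C0 \<Longrightarrow> Phat (s + t) f = Phat s (Phat t f)"
    and strongly_continuous: "f \<in> C0 \<Longrightarrow> ((\<lambda>t. Phat t f) \<longlongrightarrow> f) (at_right 0)"
    and sub_markov: "0 \<le> t \<Longrightarrow> f \<in> C0 \<Longrightarrow> (\<And>x. 0 \<le> apply_bcontfun f x \<and> apply_bcontfun f x \<le> 1)
      \<Longrightarrow> 0 \<le> apply_bcontfun (Phat t f) x \<and> apply_bcontfun (Phat t f) x \<le> 1"

text \<open>For \<open>s \<le> t\<^sub>1 \<le> \<dots> \<le> t\<^sub>n\<close>, \<open>path_prob P s x [(t\<^sub>1,A\<^sub>1),\<dots>,(t\<^sub>n,A\<^sub>n)]\<close> is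
  \<open>\<integral>\<^bsub>A\<^sub>1\<^esub> P\<^bsub>t\<^sub>1-s\<^esub>(x,dx\<^sub>1) \<dots> \<integral>\<^bsub>A\<^sub>n\<^esub> P\<^bsub>t\<^sub>n-t\<^sub>n\<^sub>-\<^sub>1\<^esub>(x\<^sub>n\<^sub>-\<^sub>1,dx\<^sub>n)\<close>.\<close>

primrec path_prob ::
    "(real \<Rightarrow> 'a \<Rightarrow> 'a measure) \<Rightarrow> real \<Rightarrow> 'a \<Rightarrow> (real \<times> 'a set) list \<Rightarrow> ennreal" where
  "path_prob P s x [] = 1"
| "path_prob P s x (p # ps) =
     (\<integral>\<^sup>+ y \<in> snd p. path_prob P (fst p) y ps \<partial>P (fst p - s) x)"

text \<open>The topology of \<open>'a\<close> is also that of a complete metric \<open>dist\<close>, which every locally compact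
  Hausdorff space with a countable base admits; only its topology is used below, and \<open>\<Delta>\<close> is an
  independent metric. The evaluation \<open>\<sigma>\<close>-algebra may be smaller than the Borel \<open>\<sigma>\<close>-algebra
  of the uniform topology, so weak continuity is required of those bounded continuous functionals
  that have integrals, i.e. of the measurable ones.\<close>

locale diffusion = feller_dynkin Phat
  for Phat :: "real \<Rightarrow> ('a::polish_space, real) bcontfun \<Rightarrow> ('a, real) bcontfun" +
  fixes \<Delta> :: "'a \<Rightarrow> 'a \<Rightarrow> real"
    and P :: "real \<Rightarrow> 'a \<Rightarrow> 'a measure"
    and Law :: "'a \<Rightarrow> (real \<Rightarrow> 'a) measure"
    and obs :: "'a \<Rightarrow> real"
  assumes locally_compact: "locally_compact_space (euclidean :: 'a topology)"
    and metric: "Metric_space UNIV \<Delta>"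
    and metric_topology: "Metric_space.mtopology UNIV \<Delta> = euclidean"
    and metric_le_1: "\<Delta> x y \<le> 1"
    and markov_kernel: "0 \<le> t \<Longrightarrow> P t \<in> borel \<rightarrow>\<^sub>M prob_algebra borel"
    and kernel_represents: "0 \<le> t \<Longrightarrow> f \<in> C0 \<Longrightarrow>
      apply_bcontfun (Phat t f) x = (\<integral>y. apply_bcontfun f y \<partial>P t x)"
    and Law_in_prob_algebra: "Law x \<in> space (prob_algebra traj_algebra)"
    and Law_finite_dim: "sorted (map fst ps) \<Longrightarrow> (\<forall>(t, A) \<in> set ps. 0 \<le> t \<and> A \<in> sets borel) \<Longrightarrow>
      emeasure (Law x) {\<omega> \<in> trajectories. \<forall>(t, A) \<in> set ps. \<omega> t \<in> A} = path_prob P 0 x ps"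
    and Law_weakly_continuous:
      "continuous_map (traj_topology \<Delta>) euclideanreal h \<Longrightarrow> h \<in> borel_measurable traj_algebra \<Longrightarrow>
       (\<And>\<omega>. \<omega> \<in> trajectories \<Longrightarrow> \<bar>h \<omega>\<bar> \<le> B) \<Longrightarrow>
       continuous_on UNIV (\<lambda>x. \<integral>\<omega>. h \<omega> \<partial>Law x)"
    and obs_continuous: "continuous_on UNIV obs"
    and obs_range: "obs x \<in> {0..1}"


section \<open>Optimal transport and the pseudometric \<open>dbar\<close>\<close>

definition couplings :: "'b measure \<Rightarrow> 'b measure \<Rightarrow> ('b \<times> 'b) measure set" where
  "couplings \<mu> \<nu> = {\<gamma>. sets \<gamma> = sets (\<mu> \<Otimes>\<^sub>M \<nu>) \<and> distr \<gamma> \<mu> fst = \<mu> \<and> distr \<gamma> \<nu> snd = \<nu>}"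

definition transport_cost :: "('b \<Rightarrow> 'b \<Rightarrow> real) \<Rightarrow> 'b measure \<Rightarrow> 'b measure \<Rightarrow> real" where
  "transport_cost c \<mu> \<nu> = (INF \<gamma>\<in>couplings \<mu> \<nu>. \<integral>p. c (fst p) (snd p) \<partial>\<gamma>)"

definition G_op ::
    "('a \<Rightarrow> (real \<Rightarrow> 'a) measure) \<Rightarrow> real \<Rightarrow> ('a \<Rightarrow> 'a \<Rightarrow> real) \<Rightarrow> 'a \<Rightarrow> 'a \<Rightarrow> real" where
  "G_op Law c m x y = transport_cost (disc_unif_dist c m) (Law x) (Law y)"

primrec d_seq ::
    "('a \<Rightarrow> (real \<Rightarrow> 'a) measure) \<Rightarrow> ('a \<Rightarrow> real) \<Rightarrow> real \<Rightarrow> nat \<Rightarrow> 'a \<Rightarrow> 'a \<Rightarrow> real" where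
  "d_seq Law obs c 0 = (\<lambda>x y. \<bar>obs x - obs y\<bar>)"
| "d_seq Law obs c (Suc n) = G_op Law c (d_seq Law obs c n)"

definition dbar ::
    "('a \<Rightarrow> (real \<Rightarrow> 'a) measure) \<Rightarrow> ('a \<Rightarrow> real) \<Rightarrow> real \<Rightarrow> 'a \<Rightarrow> 'a \<Rightarrow> real" where
  "dbar Law obs c x y = (SUP n. d_seq Law obs c n x y)"


section \<open>The logic and the pseudometric \<open>ell\<close>\<close>

typedef unit_rat = "{0..1::rat}"
  by (rule exI[of _ 0]) simp

typedef time_rat = "{0::rat..}"
  by (rule exI[of _ 0]) simp

datatype state_form =
    SConst unit_rat
  | SObs
  | SNeg state_form
  | SInt traj_form
and traj_form =
    TEval state_form time_rat
  | TMin traj_form traj_form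
  | TMax traj_form traj_form
  | TMinus traj_form unit_rat
  | TPlus traj_form unit_rat

primrec state_sem :: "('a \<Rightarrow> (real \<Rightarrow> 'a) measure) \<Rightarrow> ('a \<Rightarrow> real) \<Rightarrow> real \<Rightarrow> state_form \<Rightarrow> 'a \<Rightarrow> real"
  and traj_sem ::
    "('a \<Rightarrow> (real \<Rightarrow> 'a) measure) \<Rightarrow> ('a \<Rightarrow> real) \<Rightarrow> real \<Rightarrow> traj_form \<Rightarrow> (real \<Rightarrow> 'a) \<Rightarrow> real" where
  "state_sem Law obs c (SConst q) = (\<lambda>x. of_rat (Rep_unit_rat q))"
| "state_sem Law obs c SObs = obs"
| "state_sem Law obs c (SNeg f) = (\<lambda>x. 1 - state_sem Law obs c f x)"
| "state_sem Law obs c (SInt g) = (\<lambda>x. \<integral>\<omega>. traj_sem Law obs c g \<omega> \<partial>Law x)"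
| "traj_sem Law obs c (TEval f t) =
     (\<lambda>\<omega>. c powr of_rat (Rep_time_rat t) * state_sem Law obs c f (\<omega> (of_rat (Rep_time_rat t))))"
| "traj_sem Law obs c (TMin g h) = (\<lambda>\<omega>. min (traj_sem Law obs c g \<omega>) (traj_sem Law obs c h \<omega>))"
| "traj_sem Law obs c (TMax g h) = (\<lambda>\<omega>. max (traj_sem Law obs c g \<omega>) (traj_sem Law obs c h \<omega>))"
| "traj_sem Law obs c (TMinus g q) = (\<lambda>\<omega>. max 0 (traj_sem Law obs c g \<omega> - of_rat (Rep_unit_rat q)))"
| "traj_sem Law obs c (TPlus g q) = (\<lambda>\<omega>. min 1 (traj_sem Law obs c g \<omega> + of_rat (Rep_unit_rat q)))"

definition ell ::
    "('a \<Rightarrow> (real \<Rightarrow> 'a) measure) \<Rightarrow> ('a \<Rightarrow> real) \<Rightarrow> real \<Rightarrow> 'a \<Rightarrow> 'a \<Rightarrow> real" where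
  "ell Law obs c x y = (SUP f. \<bar>state_sem Law obs c f x - state_sem Law obs c f y\<bar>)"

end

theory Submission
  imports Defs
begin

text \<open>By induction on \<open>n\<close>, \<open>d\<^sub>n\<close> is a continuous pseudometric and the supremum of
  \<open>\<bar>f x - f y\<bar>\<close> over the state formulas \<open>f\<close> with at most \<open>n\<close> nested integrals. Trajectory
  formulas over these are non-expansive for \<open>U\<^sub>c(d\<^sub>n)\<close>, so testing against them bounds the
  transport cost from below. For the converse no compactness of measures is needed: as \<open>c < 1\<close> and
  \<open>d\<^sub>n\<close> is continuous, trajectory space is separable for \<open>U\<^sub>c(d\<^sub>n)\<close>, so up to a small mass
  both laws are spread over finitely many small \<open>U\<^sub>c(d\<^sub>n)\<close>-balls. Finite Kantorovich duality for
  the centres yields a plan, which spreads out to a coupling of the laws, and a potential, which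
  lattice combinations of formulas \<open>f \<circ> ev\<^sub>t\<close> approximate at the centres and hence, by
  non-expansiveness, on the balls. Cutting the laws up by a continuous partition of unity
  turns weak continuity of \<open>x \<mapsto> P\<^sup>x\<close> into continuity of \<open>d\<^sub>n\<^sub>+\<^sub>1\<close>. Since paths start at
  their index point, \<open>obs\<close> is itself the integral of \<open>obs \<circ> ev\<^sub>0\<close> and so survives to every level.\<close>


section \<open>Finite optimal transport\<close>

text \<open>The obstacle is that the uniform topology on trajectories is in general not separable
  and that the evaluation \<sigma>-algebra may be smaller than its Borel \<sigma>-algebra, so
  tightness of the laws is out of reach. Two consequences shape the proof. The functions that cut up
  the laws must be measurable for the evaluations and, at the same time, continuous for the uniform
  topology; functions of the distances \<open>U \<omega> z\<close> to fixed trajectories are both.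
  And \<open>transport_cost\<close> is handled only as an infimum: every duality statement carries
  an arbitrary positive error. Once duality holds at a level, \<open>d (Suc n)\<close> is a supremum
  of differences of integrals, and symmetry and the triangle inequality are read off from that form,
  where they are immediate, rather than from a gluing of couplings. Continuity needs the primal side
  again, since a supremum of continuous functions is in general only lower semicontinuous.\<close>

lemma compact_box_fun:
  fixes a b :: "'i \<Rightarrow> real"
  shows "compact {\<gamma>. \<forall>p. \<gamma> p \<in> {a p..b p}}"
proof -
  have "compactin (product_topology (\<lambda>i::'i. (euclidean :: real topology)) UNIV)
      (PiE UNIV (\<lambda>p. {a p..b p}))"
    by (subst compactin_PiE) (simp add: compactin_euclidean_iff)
  moreover have "PiE UNIV (\<lambda>p. {a p..b p}) = {\<gamma>. \<forall>p. \<gamma> p \<in> {a p..b p}}"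
    by (auto simp: PiE_def)
  ultimately show ?thesis
    by (simp add: euclidean_product_topology compactin_euclidean_iff)
qed

text \<open>First-order optimality condition: divided by \<open>t\<close>, the expression tends to
  \<open>L\<close> as \<open>t\<close> tends to 0. It turns minimality of a quadratic functional
  over a convex set into a variational inequality.\<close>

lemma quadratic_nonneg_imp_slope_nonneg:
  fixes L Q :: real
  assumes "\<And>t. 0 < t \<Longrightarrow> t \<le> 1 \<Longrightarrow> 0 \<le> t * L + t\<^sup>2 * Q"
  shows "0 \<le> L"
proof (rule ccontr)
  assume "\<not> 0 \<le> L"
  then have L: "L < 0" by simp
  \<comment> \<open>With this \<open>t\<close> the term \<open>t * Q\<close> is at most
    \<open>- L / 2\<close>, so it cannot compensate the negative slope.\<close>
  define t where "t = min 1 (- L / (2 * (\<bar>Q\<bar> + 1)))"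
  have "0 < - L / (2 * (\<bar>Q\<bar> + 1))" using L by (intro divide_pos_pos) auto
  then have t: "0 < t" "t \<le> 1" by (simp_all only: t_def min_less_iff_conj) auto
  have "t * (2 * (\<bar>Q\<bar> + 1)) \<le> - L"
    using mult_right_mono[of t "- L / (2 * (\<bar>Q\<bar> + 1))" "2 * (\<bar>Q\<bar> + 1)"]
    by (simp add: t_def)
  moreover have "t * Q \<le> t * (2 * (\<bar>Q\<bar> + 1)) / 2"
    using mult_left_mono[of Q "\<bar>Q\<bar> + 1" t] t by (simp add: mult.commute)
  ultimately have "L + t * Q < 0" using L by linarith
  then have "t * (L + t * Q) < 0" using t by (simp add: mult_pos_neg)
  then show False using assms[OF t] by (simp add: power2_eq_square algebra_simps)
qed

text \<open>Penalty method: the first marginal is kept as a constraint, the second is enforced only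
  by a quadratic penalty. A minimiser exists by compactness, and the gradient of the penalty there
  supplies the dual potential. The price is a second marginal that is correct only up to \<delta>;
  cost and potential are compared without error.\<close>

lemma finite_transport_penalised:
  fixes D :: "'i \<Rightarrow> 'i \<Rightarrow> real" and m n :: "'i \<Rightarrow> real"
  assumes fin: "finite I" and ne: "I \<noteq> {}"
    and D0: "\<And>i. i \<in> I \<Longrightarrow> D i i = 0"
    and Dsym: "\<And>i j. i \<in> I \<Longrightarrow> j \<in> I \<Longrightarrow> D i j = D j i"
    and Dtri: "\<And>i j k. i \<in> I \<Longrightarrow> j \<in> I \<Longrightarrow> k \<in> I \<Longrightarrow> D i k \<le> D i j + D j k"
    and Dnn: "\<And>i j. i \<in> I \<Longrightarrow> j \<in> I \<Longrightarrow> 0 \<le> D i j"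
    and D1: "\<And>i j. i \<in> I \<Longrightarrow> j \<in> I \<Longrightarrow> D i j \<le> 1"
    and m: "\<And>i. i \<in> I \<Longrightarrow> 0 \<le> m i" "sum m I = 1"
    and n: "\<And>i. i \<in> I \<Longrightarrow> 0 \<le> n i" "sum n I = 1"
    and \<delta>: "0 < \<delta>"
  obtains \<gamma> h where "\<And>i j. i \<in> I \<Longrightarrow> j \<in> I \<Longrightarrow> 0 \<le> \<gamma> i j"
    and "\<And>i. i \<in> I \<Longrightarrow> (\<Sum>j\<in>I. \<gamma> i j) = m i"
    and "(\<Sum>j\<in>I. \<bar>(\<Sum>i\<in>I. \<gamma> i j) - n j\<bar>) \<le> \<delta>"
    and "(\<Sum>i\<in>I. \<Sum>j\<in>I. \<gamma> i j * D i j) \<le> (\<Sum>i\<in>I. h i * (m i - n i))"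
    and "\<And>i j. i \<in> I \<Longrightarrow> j \<in> I \<Longrightarrow> \<bar>h i - h j\<bar> \<le> D i j"
proof -
  \<comment> \<open>The product plan has penalty 0 and cost at most 1, so the penalty at the
    minimiser is at most 1. Hence the squared column errors sum to at most
    \<open>2 * \<kappa>\<close>, each error is at most \<open>\<delta> / card I\<close>, and their
    sum at most \<delta>.\<close>
  define \<kappa> where "\<kappa> = (\<delta> / card I)\<^sup>2 / 2"
  have cI: "card I > 0" using fin ne by (simp add: card_gt_0_iff)
  have \<kappa>: "0 < \<kappa>" using cI \<delta> by (simp add: \<kappa>_def)
  \<comment> \<open>Entries outside \<open>I \<times> I\<close> are pinned to 0, so that
    \<open>K\<close> sits in a box and is compact in the product topology even if the index type is
    infinite.\<close>
  define K where "K = {\<gamma> :: 'i \<times> 'i \<Rightarrow> real.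
      (\<forall>p. \<gamma> p \<in> {0..(if p \<in> I \<times> I then 1 else 0)}) \<and> (\<forall>i\<in>I. (\<Sum>j\<in>I. \<gamma> (i, j)) = m i)}"
  define s where "s \<gamma> j = (\<Sum>i\<in>I. \<gamma> (i, j))" for \<gamma> :: "'i \<times> 'i \<Rightarrow> real" and j
  define F where "F \<gamma> = (\<Sum>i\<in>I. \<Sum>j\<in>I. \<gamma> (i, j) * D i j) + (\<Sum>j\<in>I. (n j - s \<gamma> j)\<^sup>2) / (2 * \<kappa>)" for \<gamma>
  have memK: "\<gamma> \<in> K" if "\<And>i j. i \<in> I \<Longrightarrow> j \<in> I \<Longrightarrow> 0 \<le> \<gamma> (i, j)"
    "\<And>p. p \<notin> I \<times> I \<Longrightarrow> \<gamma> p = 0" "\<And>i. i \<in> I \<Longrightarrow> (\<Sum>j\<in>I. \<gamma> (i, j)) = m i" for \<gamma>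
  proof -
    have "\<gamma> (i, j) \<le> 1" if ij: "i \<in> I" "j \<in> I" for i j
    proof -
      have "\<gamma> (i, j) \<le> (\<Sum>j\<in>I. \<gamma> (i, j))"
        using fin ij that(1) \<open>\<And>i j. i \<in> I \<Longrightarrow> j \<in> I \<Longrightarrow> 0 \<le> \<gamma> (i, j)\<close> by (intro member_le_sum) auto
      also have "\<dots> = m i" using \<open>\<And>i. i \<in> I \<Longrightarrow> (\<Sum>j\<in>I. \<gamma> (i, j)) = m i\<close> ij by simp
      also have "\<dots> \<le> sum m I" using fin ij m by (intro member_le_sum) auto
      finally show ?thesis using m by simp
    qed
    then show ?thesis unfolding K_def using that by (auto split: if_splits)
  qed
  have compK: "compact K"
  proof -
    have "K = {\<gamma>. \<forall>p. \<gamma> p \<in> {(\<lambda>_. 0) p..(\<lambda>p. if p \<in> I \<times> I then 1 else 0) p}} \<inter>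
        (\<Inter>i\<in>I. {\<gamma>. (\<Sum>j\<in>I. \<gamma> (i, j)) = m i})"
      unfolding K_def by auto
    moreover have "closed (\<Inter>i\<in>I. {\<gamma> :: 'i \<times> 'i \<Rightarrow> real. (\<Sum>j\<in>I. \<gamma> (i, j)) = m i})"
      by (intro closed_INT ballI closed_Collect_eq continuous_intros) auto
    ultimately show ?thesis
      using compact_Int_closed[OF compact_box_fun[of "\<lambda>_. 0" "\<lambda>p. if p \<in> I \<times> I then 1 else 0"]]
      by simp
  qed
  define \<pi> where "\<pi> = (\<lambda>p. if p \<in> I \<times> I then m (fst p) * n (snd p) else 0)"
  have \<pi>K: "\<pi> \<in> K"
    by (rule memK) (auto simp: \<pi>_def m n sum_distrib_left[symmetric])
  have "continuous_on K F"
    unfolding F_def s_def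
    by (intro continuous_intros continuous_on_subset[OF continuous_on_product_coordinates])
      (use \<kappa> in auto)
  then obtain \<gamma> where \<gamma>K: "\<gamma> \<in> K" and \<gamma>min: "\<And>\<gamma>'. \<gamma>' \<in> K \<Longrightarrow> F \<gamma> \<le> F \<gamma>'"
    using continuous_attains_inf[OF compK] \<pi>K by blast
  have \<gamma>nn: "0 \<le> \<gamma> (i, j)" for i j using \<gamma>K unfolding K_def by auto
  have \<gamma>out: "\<gamma> p = 0" if "p \<notin> I \<times> I" for p
  proof -
    have "\<gamma> p \<in> {0..(if p \<in> I \<times> I then 1 else 0)}" using \<gamma>K unfolding K_def by blast
    then show ?thesis using that by simp
  qed
  have \<gamma>row: "(\<Sum>j\<in>I. \<gamma> (i, j)) = m i" if "i \<in> I" for i using \<gamma>K that unfolding K_def by auto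
  \<comment> \<open>\<open>D i j - v j\<close> is the partial derivative of \<open>F\<close> at
    \<gamma> in the entry \<open>(i, j)\<close>. The function \<open>h\<close> below is the
    transform of \<open>v\<close> with respect to the cost \<open>D\<close>, and the triangle
    inequality makes it 1-Lipschitz.\<close>
  define v where "v j = (n j - s \<gamma> j) / \<kappa>" for j
  define h where "h i = Min ((\<lambda>k. D i k - v k) ` I)" for i
  have h_le: "h i \<le> D i k - v k" if "k \<in> I" for i k
    unfolding h_def using fin that by (intro Min_le) auto
  have "\<exists>k\<in>I. h i = D i k - v k" for i
    using Min_in[of "(\<lambda>k. D i k - v k) ` I"] fin ne unfolding h_def by (simp add: image_iff)
  then obtain a where a: "\<And>i. a i \<in> I" "\<And>i. h i = D i (a i) - v (a i)" by metis
  text \<open>The functional linearised at the minimiser \<open>\<gamma>\<close> is minimal at \<open>\<gamma>\<close> as well, so \<open>v\<close>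
    takes the role of a dual potential for the second marginal.\<close>
  have lin: "(\<Sum>i\<in>I. \<Sum>j\<in>I. \<gamma> (i, j) * (D i j - v j)) \<le> (\<Sum>i\<in>I. \<Sum>j\<in>I. \<gamma>' (i, j) * (D i j - v j))"
    if \<gamma>'K: "\<gamma>' \<in> K" for \<gamma>'
  proof -
    define E where "E p = \<gamma>' p - \<gamma> p" for p
    define L where "L = (\<Sum>i\<in>I. \<Sum>j\<in>I. E (i, j) * (D i j - v j))"
    have "0 \<le> L"
    proof (rule quadratic_nonneg_imp_slope_nonneg)
      fix t :: real assume t: "0 < t" "t \<le> 1"
      define \<gamma>t where "\<gamma>t p = \<gamma> p + t * E p" for p
      have \<gamma>t_alt: "\<gamma>t p = (1 - t) * \<gamma> p + t * \<gamma>' p" for p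
        by (simp add: \<gamma>t_def E_def algebra_simps)
      have "\<gamma>t \<in> K"
      proof (rule memK)
        show "0 \<le> \<gamma>t (i, j)" for i j
          using \<gamma>'K t \<gamma>nn[of i j] unfolding \<gamma>t_alt K_def by auto
        show "\<gamma>t p = 0" if "p \<notin> I \<times> I" for p
        proof -
          have "\<gamma>' p \<in> {0..(if p \<in> I \<times> I then 1 else 0)}" using \<gamma>'K unfolding K_def by blast
          then have "\<gamma>' p = 0" using that by simp
          then show ?thesis using \<gamma>out[OF that] by (simp add: \<gamma>t_alt)
        qed
        show "(\<Sum>j\<in>I. \<gamma>t (i, j)) = m i" if "i \<in> I" for i
        proof -
          have "(\<Sum>j\<in>I. \<gamma>' (i, j)) = m i" using \<gamma>'K that unfolding K_def by auto
          then show ?thesis using \<gamma>row[OF that]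
            by (simp add: \<gamma>t_alt sum.distrib sum_distrib_left[symmetric])
              (simp add: algebra_simps)
        qed
      qed
      then have "F \<gamma> \<le> F \<gamma>t" by (rule \<gamma>min)
      moreover have "F \<gamma>t = F \<gamma> + t * L + t\<^sup>2 * ((\<Sum>j\<in>I. (s E j)\<^sup>2) / (2 * \<kappa>))"
      proof -
        have st: "s \<gamma>t j = s \<gamma> j + t * s E j" for j
          by (simp add: s_def \<gamma>t_def sum.distrib sum_distrib_left)
        have 1: "(\<Sum>i\<in>I. \<Sum>j\<in>I. \<gamma>t (i, j) * D i j) =
            (\<Sum>i\<in>I. \<Sum>j\<in>I. \<gamma> (i, j) * D i j) + t * (\<Sum>i\<in>I. \<Sum>j\<in>I. E (i, j) * D i j)"
          by (simp add: \<gamma>t_def sum.distrib sum_distrib_left algebra_simps)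
        have "(\<Sum>j\<in>I. (n j - s \<gamma>t j)\<^sup>2) =
            (\<Sum>j\<in>I. (n j - s \<gamma> j)\<^sup>2 - 2 * \<kappa> * t * (v j * s E j) + t\<^sup>2 * (s E j)\<^sup>2)"
          using \<kappa> by (intro sum.cong) (auto simp: st v_def power2_eq_square field_simps)
        also have "\<dots> = (\<Sum>j\<in>I. (n j - s \<gamma> j)\<^sup>2) - 2 * \<kappa> * t * (\<Sum>j\<in>I. v j * s E j)
            + t\<^sup>2 * (\<Sum>j\<in>I. (s E j)\<^sup>2)"
          by (simp add: sum.distrib sum_subtractf sum_distrib_left)
        finally have 2: "(\<Sum>j\<in>I. (n j - s \<gamma>t j)\<^sup>2) / (2 * \<kappa>) = (\<Sum>j\<in>I. (n j - s \<gamma> j)\<^sup>2) / (2 * \<kappa>)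
            - t * (\<Sum>j\<in>I. v j * s E j) + t\<^sup>2 * ((\<Sum>j\<in>I. (s E j)\<^sup>2) / (2 * \<kappa>))"
          using \<kappa> by (simp add: field_simps)
        have "(\<Sum>j\<in>I. v j * s E j) = (\<Sum>i\<in>I. \<Sum>j\<in>I. E (i, j) * v j)"
          unfolding s_def sum_distrib_left by (subst sum.swap) (simp add: mult.commute)
        then have 3: "L = (\<Sum>i\<in>I. \<Sum>j\<in>I. E (i, j) * D i j) - (\<Sum>j\<in>I. v j * s E j)"
          by (simp add: L_def algebra_simps sum_subtractf)
        show ?thesis unfolding F_def 1 2 3 by (simp add: algebra_simps)
      qed
      ultimately show "0 \<le> t * L + t\<^sup>2 * ((\<Sum>j\<in>I. (s E j)\<^sup>2) / (2 * \<kappa>))" by simp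
    qed
    then show ?thesis by (simp add: L_def E_def algebra_simps sum_subtractf sum.distrib)
  qed
  \<comment> \<open>The cheapest plan for the linearised cost: all of row \<open>i\<close> goes to
    the column \<open>a i\<close> at which the minimum defining \<open>h i\<close> is
    attained.\<close>
  define \<gamma>0 where "\<gamma>0 = (\<lambda>p. if p \<in> I \<times> I \<and> snd p = a (fst p) then m (fst p) else 0)"
  have "\<gamma>0 \<in> K"
    by (rule memK) (auto simp: \<gamma>0_def m a fin if_distrib cong: if_cong)
  from lin[OF this] have "(\<Sum>i\<in>I. \<Sum>j\<in>I. \<gamma> (i, j) * (D i j - v j)) \<le>
      (\<Sum>i\<in>I. \<Sum>j\<in>I. \<gamma>0 (i, j) * (D i j - v j))" .
  also have "\<dots> = (\<Sum>i\<in>I. m i * h i)"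
  proof (rule sum.cong[OF refl])
    fix i assume "i \<in> I"
    then have "(\<Sum>j\<in>I. \<gamma>0 (i, j) * (D i j - v j)) = (\<Sum>j\<in>I. if j = a i then m i * (D i j - v j) else 0)"
      by (intro sum.cong) (auto simp: \<gamma>0_def)
    also have "\<dots> = m i * h i" using fin a by simp
    finally show "(\<Sum>j\<in>I. \<gamma>0 (i, j) * (D i j - v j)) = m i * h i" .
  qed
  finally have A: "(\<Sum>i\<in>I. \<Sum>j\<in>I. \<gamma> (i, j) * (D i j - v j)) \<le> (\<Sum>i\<in>I. m i * h i)" .
  have "(\<Sum>j\<in>I. v j * s \<gamma> j) = (\<Sum>i\<in>I. \<Sum>j\<in>I. \<gamma> (i, j) * v j)"
    unfolding s_def sum_distrib_left by (subst sum.swap) (simp add: mult.commute)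
  then have B: "(\<Sum>i\<in>I. \<Sum>j\<in>I. \<gamma> (i, j) * D i j) \<le> (\<Sum>i\<in>I. m i * h i) + (\<Sum>j\<in>I. v j * s \<gamma> j)"
    using A by (simp add: algebra_simps sum_subtractf)
  \<comment> \<open>Replacing \<open>s \<gamma> j\<close> by \<open>n j\<close> costs a square with
    the favourable sign, and \<open>v j \<le> - h j\<close> because the diagonal entry
    \<open>D j j = 0\<close> competes in the minimum.\<close>
  have "(\<Sum>j\<in>I. v j * s \<gamma> j) \<le> (\<Sum>j\<in>I. - h j * n j)"
  proof (rule sum_mono)
    fix j assume j: "j \<in> I"
    have "v j * s \<gamma> j = v j * n j - \<kappa> * (v j)\<^sup>2"
      using \<kappa> by (simp add: v_def power2_eq_square field_simps)
    also have "\<dots> \<le> v j * n j" using \<kappa> by simp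
    also have "\<dots> \<le> - h j * n j"
      using h_le[OF j, of j] D0[OF j] n(1)[OF j] by (intro mult_right_mono) auto
    finally show "v j * s \<gamma> j \<le> - h j * n j" .
  qed
  with B have C: "(\<Sum>i\<in>I. \<Sum>j\<in>I. \<gamma> (i, j) * D i j) \<le> (\<Sum>i\<in>I. h i * (m i - n i))"
    by (simp add: algebra_simps sum_subtractf sum_negf)
  have lip: "h i - h j \<le> D i j" if "i \<in> I" "j \<in> I" for i j
  proof -
    have "h i \<le> D i (a j) - v (a j)" using h_le a by blast
    also have "\<dots> \<le> D i j + (D j (a j) - v (a j))" using Dtri[OF that a(1)[of j]] by simp
    finally show ?thesis using a(2)[of j] by simp
  qed
  have res: "(\<Sum>j\<in>I. \<bar>s \<gamma> j - n j\<bar>) \<le> \<delta>"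
  proof -
    have "s \<pi> j = n j" if "j \<in> I" for j
    proof -
      have "s \<pi> j = (\<Sum>i\<in>I. m i) * n j"
        unfolding s_def sum_distrib_right by (intro sum.cong) (auto simp: \<pi>_def that)
      then show ?thesis by (simp add: m)
    qed
    then have "F \<pi> = (\<Sum>i\<in>I. \<Sum>j\<in>I. \<pi> (i, j) * D i j)" by (simp add: F_def)
    also have "\<dots> \<le> (\<Sum>i\<in>I. \<Sum>j\<in>I. \<pi> (i, j) * 1)"
      by (intro sum_mono mult_left_mono D1) (auto simp: \<pi>_def m n)
    also have "\<dots> = 1" using \<pi>K m unfolding K_def by simp
    finally have "F \<gamma> \<le> 1" using \<gamma>min[OF \<pi>K] by simp
    moreover have "0 \<le> (\<Sum>i\<in>I. \<Sum>j\<in>I. \<gamma> (i, j) * D i j)"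
      by (intro sum_nonneg mult_nonneg_nonneg \<gamma>nn Dnn)
    ultimately have q: "(\<Sum>j\<in>I. (n j - s \<gamma> j)\<^sup>2) \<le> 2 * \<kappa>"
      using \<kappa> by (simp add: F_def field_simps) (smt (verit) mult_nonneg_nonneg)
    have "\<bar>s \<gamma> j - n j\<bar> \<le> \<delta> / card I" if "j \<in> I" for j
    proof -
      have "(n j - s \<gamma> j)\<^sup>2 \<le> (\<Sum>j\<in>I. (n j - s \<gamma> j)\<^sup>2)" using fin that by (intro member_le_sum) auto
      then have "(n j - s \<gamma> j)\<^sup>2 \<le> (\<delta> / card I)\<^sup>2" using q by (simp add: \<kappa>_def)
      then have "\<bar>n j - s \<gamma> j\<bar> \<le> \<delta> / card I"
        using \<delta> by (intro abs_le_square_iff[THEN iffD2, of "n j - s \<gamma> j" "\<delta> / card I", THEN order_trans]) auto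
      then show ?thesis by (simp add: abs_minus_commute)
    qed
    then have "(\<Sum>j\<in>I. \<bar>s \<gamma> j - n j\<bar>) \<le> (\<Sum>j\<in>I. \<delta> / card I)" by (rule sum_mono)
    then show ?thesis using cI by simp
  qed
  show thesis
  proof (rule that[of "\<lambda>i j. \<gamma> (i, j)" h])
    show "\<bar>h i - h j\<bar> \<le> D i j" if "i \<in> I" "j \<in> I" for i j
      using lip[OF that] lip[OF that(2,1)] Dsym[OF that] by linarith
  qed (use \<gamma>nn \<gamma>row C res in \<open>auto simp: s_def\<close>)
qed

text \<open>Repair of an approximate plan: shrink the columns that are too heavy and distribute the
  mass removed by a product plan.\<close>

lemma plan_repair:
  fixes D \<gamma> :: "'i \<Rightarrow> 'i \<Rightarrow> real" and m n :: "'i \<Rightarrow> real"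
  assumes fin: "finite I"
    and Dnn: "\<And>i j. i \<in> I \<Longrightarrow> j \<in> I \<Longrightarrow> 0 \<le> D i j"
    and D1: "\<And>i j. i \<in> I \<Longrightarrow> j \<in> I \<Longrightarrow> D i j \<le> 1"
    and n: "\<And>i. i \<in> I \<Longrightarrow> 0 \<le> n i" and mn: "sum m I = sum n I"
    and \<gamma>: "\<And>i j. i \<in> I \<Longrightarrow> j \<in> I \<Longrightarrow> 0 \<le> \<gamma> i j"
    and row: "\<And>i. i \<in> I \<Longrightarrow> (\<Sum>j\<in>I. \<gamma> i j) = m i"
    and col: "(\<Sum>j\<in>I. \<bar>(\<Sum>i\<in>I. \<gamma> i j) - n j\<bar>) \<le> \<delta>"
  obtains \<eta> where "\<And>i j. i \<in> I \<Longrightarrow> j \<in> I \<Longrightarrow> 0 \<le> \<eta> i j"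
    and "\<And>i. i \<in> I \<Longrightarrow> (\<Sum>j\<in>I. \<eta> i j) = m i"
    and "\<And>j. j \<in> I \<Longrightarrow> (\<Sum>i\<in>I. \<eta> i j) = n j"
    and "(\<Sum>i\<in>I. \<Sum>j\<in>I. \<eta> i j * D i j) \<le> (\<Sum>i\<in>I. \<Sum>j\<in>I. \<gamma> i j * D i j) + \<delta>"
proof -
  define s where "s j = (\<Sum>i\<in>I. \<gamma> i j)" for j
  define w where "w j = (if s j \<le> n j then 1 else n j / s j)" for j
  define a where "a i = (\<Sum>j\<in>I. \<gamma> i j * (1 - w j))" for i
  define b where "b j = n j - w j * s j" for j
  define R where "R = sum a I"
  have w01: "0 \<le> w j" "w j \<le> 1" if "j \<in> I" for j
    using n[OF that] by (auto simp: w_def field_simps)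
  have ann: "0 \<le> a i" if "i \<in> I" for i
    unfolding a_def using that \<gamma> w01 by (intro sum_nonneg mult_nonneg_nonneg) auto
  have bnn: "0 \<le> b j" if "j \<in> I" for j
    using n[OF that] by (auto simp: b_def w_def field_simps)
  have a_alt: "R = (\<Sum>j\<in>I. s j * (1 - w j))"
    unfolding R_def a_def s_def sum_distrib_right by (rule sum.swap)
  have "sum s I = sum n I"
    unfolding s_def using mn row by (subst sum.swap) simp
  then have Rb: "sum b I = R"
    unfolding a_alt b_def by (simp add: algebra_simps sum_subtractf)
  \<comment> \<open>The mass \<open>s j * (1 - w j)\<close> removed from column \<open>j\<close> is
    the positive part of \<open>s j - n j\<close>.\<close>
  have "R \<le> (\<Sum>j\<in>I. \<bar>s j - n j\<bar>)"
    unfolding a_alt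
  proof (rule sum_mono)
    fix j assume "j \<in> I"
    then show "s j * (1 - w j) \<le> \<bar>s j - n j\<bar>"
      using n[of j] by (auto simp: w_def right_diff_distrib)
  qed
  then have R\<delta>: "R \<le> \<delta>" using col by (simp add: s_def)
  have Rnn: "0 \<le> R" unfolding R_def by (intro sum_nonneg ann)
  have a0: "a i = 0" if "R = 0" "i \<in> I" for i
    using that fin ann by (simp add: R_def sum_nonneg_eq_0_iff)
  have b0: "b j = 0" if "R = 0" "j \<in> I" for j
    using that fin bnn Rb by (simp add: sum_nonneg_eq_0_iff)
  \<comment> \<open>For \<open>R = 0\<close> the division gives 0, which is the right correction:
    then no row or column has a deficit, by \<open>a0\<close> and \<open>b0\<close>.\<close>
  define \<eta> where "\<eta> i j = \<gamma> i j * w j + a i * b j / R" for i j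
  show thesis
  proof (rule that[of \<eta>])
    show "0 \<le> \<eta> i j" if "i \<in> I" "j \<in> I" for i j
      using that \<gamma> w01 ann bnn Rnn by (simp add: \<eta>_def)
    show "(\<Sum>j\<in>I. \<eta> i j) = m i" if "i \<in> I" for i
    proof -
      have "(\<Sum>j\<in>I. a i * b j / R) = a i"
        using Rb a0[OF _ that] by (cases "R = 0") (simp_all add: sum_divide_distrib[symmetric] sum_distrib_left[symmetric])
      moreover have "(\<Sum>j\<in>I. \<gamma> i j * w j) = m i - a i"
        using row[OF that] by (simp add: a_def algebra_simps sum_subtractf)
      ultimately show ?thesis by (simp add: \<eta>_def sum.distrib)
    qed
    show "(\<Sum>i\<in>I. \<eta> i j) = n j" if "j \<in> I" for j
    proof -
      have "(\<Sum>i\<in>I. a i * b j / R) = b j"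
        using b0[OF _ that] by (cases "R = 0") (simp_all add: sum_divide_distrib[symmetric] sum_distrib_right[symmetric] R_def[symmetric])
      moreover have "(\<Sum>i\<in>I. \<gamma> i j * w j) = n j - b j"
        by (simp add: b_def s_def sum_distrib_left mult.commute)
      ultimately show ?thesis by (simp add: \<eta>_def sum.distrib)
    qed
    have "(\<Sum>i\<in>I. \<Sum>j\<in>I. \<eta> i j * D i j) \<le> (\<Sum>i\<in>I. \<Sum>j\<in>I. \<gamma> i j * D i j + a i * b j / R)"
    proof (intro sum_mono)
      fix i j assume ij: "i \<in> I" "j \<in> I"
      have "\<gamma> i j * w j * D i j \<le> \<gamma> i j * 1 * D i j"
        using ij \<gamma> w01 Dnn by (intro mult_right_mono mult_left_mono) auto
      moreover have "a i * b j / R * D i j \<le> a i * b j / R * 1"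
        using ij ann bnn Rnn D1 by (intro mult_left_mono) auto
      ultimately show "\<eta> i j * D i j \<le> \<gamma> i j * D i j + a i * b j / R"
        by (simp add: \<eta>_def algebra_simps)
    qed
    also have "\<dots> = (\<Sum>i\<in>I. \<Sum>j\<in>I. \<gamma> i j * D i j) + (\<Sum>i\<in>I. \<Sum>j\<in>I. a i * b j / R)"
      by (simp add: sum.distrib)
    also have "(\<Sum>i\<in>I. \<Sum>j\<in>I. a i * b j / R) = sum a I * sum b I / R"
      by (simp add: sum_product sum_divide_distrib)
    also have "\<dots> = R" by (simp add: Rb R_def[symmetric])
    finally show "(\<Sum>i\<in>I. \<Sum>j\<in>I. \<eta> i j * D i j) \<le> (\<Sum>i\<in>I. \<Sum>j\<in>I. \<gamma> i j * D i j) + \<delta>"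
      using R\<delta> by simp
  qed
qed

text \<open>The penalised problem followed by the repair of its plan, which costs one \<delta>.
  Since both masses are 1, a constant may be subtracted from the potential; subtracting its minimum
  puts it into the unit interval because \<open>D\<close> is at most 1. That range is the range of
  the formulas which later have to imitate \<open>h\<close>.\<close>

lemma finite_kantorovich:
  fixes D :: "'i \<Rightarrow> 'i \<Rightarrow> real" and m n :: "'i \<Rightarrow> real"
  assumes fin: "finite I" and ne: "I \<noteq> {}"
    and D0: "\<And>i. i \<in> I \<Longrightarrow> D i i = 0"
    and Dsym: "\<And>i j. i \<in> I \<Longrightarrow> j \<in> I \<Longrightarrow> D i j = D j i"
    and Dtri: "\<And>i j k. i \<in> I \<Longrightarrow> j \<in> I \<Longrightarrow> k \<in> I \<Longrightarrow> D i k \<le> D i j + D j k"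
    and Dnn: "\<And>i j. i \<in> I \<Longrightarrow> j \<in> I \<Longrightarrow> 0 \<le> D i j"
    and D1: "\<And>i j. i \<in> I \<Longrightarrow> j \<in> I \<Longrightarrow> D i j \<le> 1"
    and m: "\<And>i. i \<in> I \<Longrightarrow> 0 \<le> m i" "sum m I = 1"
    and n: "\<And>i. i \<in> I \<Longrightarrow> 0 \<le> n i" "sum n I = 1"
    and \<delta>: "0 < \<delta>"
  obtains \<gamma> h where "\<And>i j. i \<in> I \<Longrightarrow> j \<in> I \<Longrightarrow> 0 \<le> \<gamma> i j"
    and "\<And>i. i \<in> I \<Longrightarrow> (\<Sum>j\<in>I. \<gamma> i j) = m i"
    and "\<And>j. j \<in> I \<Longrightarrow> (\<Sum>i\<in>I. \<gamma> i j) = n j"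
    and "(\<Sum>i\<in>I. \<Sum>j\<in>I. \<gamma> i j * D i j) \<le> (\<Sum>i\<in>I. h i * (m i - n i)) + \<delta>"
    and "\<And>i j. i \<in> I \<Longrightarrow> j \<in> I \<Longrightarrow> \<bar>h i - h j\<bar> \<le> D i j"
    and "\<And>i. i \<in> I \<Longrightarrow> 0 \<le> h i" and "\<And>i. i \<in> I \<Longrightarrow> h i \<le> 1"
proof -
  show thesis
  proof (rule finite_transport_penalised[of I D m n \<delta>])
    fix \<gamma> h
    assume *: "\<And>i j. i \<in> I \<Longrightarrow> j \<in> I \<Longrightarrow> 0 \<le> \<gamma> i j"
      "\<And>i. i \<in> I \<Longrightarrow> (\<Sum>j\<in>I. \<gamma> i j) = m i"
      "(\<Sum>j\<in>I. \<bar>(\<Sum>i\<in>I. \<gamma> i j) - n j\<bar>) \<le> \<delta>"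
      "(\<Sum>i\<in>I. \<Sum>j\<in>I. \<gamma> i j * D i j) \<le> (\<Sum>i\<in>I. h i * (m i - n i))"
      "\<And>i j. i \<in> I \<Longrightarrow> j \<in> I \<Longrightarrow> \<bar>h i - h j\<bar> \<le> D i j"
    show thesis
    proof (rule plan_repair[of I D n m \<gamma> \<delta>])
      fix \<eta>
      assume \<eta>: "\<And>i j. i \<in> I \<Longrightarrow> j \<in> I \<Longrightarrow> 0 \<le> \<eta> i j"
        "\<And>i. i \<in> I \<Longrightarrow> (\<Sum>j\<in>I. \<eta> i j) = m i" "\<And>j. j \<in> I \<Longrightarrow> (\<Sum>i\<in>I. \<eta> i j) = n j"
        "(\<Sum>i\<in>I. \<Sum>j\<in>I. \<eta> i j * D i j) \<le> (\<Sum>i\<in>I. \<Sum>j\<in>I. \<gamma> i j * D i j) + \<delta>"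
      define l where "l = Min (h ` I)"
      have lle: "l \<le> h i" if "i \<in> I" for i unfolding l_def using fin that by simp
      have "l \<in> h ` I" unfolding l_def using fin ne by (intro Min_in) auto
      then obtain k where k: "k \<in> I" "l = h k" by blast
      have "(\<Sum>i\<in>I. (h i - l) * (m i - n i)) = (\<Sum>i\<in>I. h i * (m i - n i)) - l * (sum m I - sum n I)"
        by (simp add: left_diff_distrib sum_subtractf sum_distrib_left right_diff_distrib)
      then have shift: "(\<Sum>i\<in>I. (h i - l) * (m i - n i)) = (\<Sum>i\<in>I. h i * (m i - n i))"
        using m n by simp
      show thesis
      proof (rule that[of \<eta> "\<lambda>i. h i - l"])
        show "h i - l \<le> 1" if "i \<in> I" for i
          using *(5)[OF that k(1)] D1[OF that k(1)] k(2) by linarith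
      qed (use \<eta> * lle shift in auto)
    qed (use fin Dnn D1 n m * in simp_all)
  qed (fact assms)+
qed


section \<open>From finite plans to couplings\<close>

lemma integrable_unit_bounded:
  fixes f :: "'b \<Rightarrow> real"
  assumes "finite_measure M" "f \<in> borel_measurable M"
    and "\<And>x. x \<in> space M \<Longrightarrow> 0 \<le> f x" and "\<And>x. x \<in> space M \<Longrightarrow> f x \<le> B"
  shows "integrable M f"
proof -
  interpret finite_measure M by fact
  show ?thesis by (rule integrable_const_bound[where B = B]) (use assms in auto)
qed

lemma (in pair_prob_space) integral_product_factor:
  fixes f :: "'a \<Rightarrow> real" and g :: "'b \<Rightarrow> real"
  assumes [measurable]: "f \<in> borel_measurable M1" "g \<in> borel_measurable M2"
    and f: "\<And>x. x \<in> space M1 \<Longrightarrow> 0 \<le> f x" "\<And>x. x \<in> space M1 \<Longrightarrow> f x \<le> 1"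
    and g: "\<And>x. x \<in> space M2 \<Longrightarrow> 0 \<le> g x" "\<And>x. x \<in> space M2 \<Longrightarrow> g x \<le> 1"
  shows "integrable (M1 \<Otimes>\<^sub>M M2) (\<lambda>p. f (fst p) * g (snd p))"
    and "(\<integral>p. f (fst p) * g (snd p) \<partial>(M1 \<Otimes>\<^sub>M M2)) = (\<integral>x. f x \<partial>M1) * (\<integral>x. g x \<partial>M2)"
proof -
  show I: "integrable (M1 \<Otimes>\<^sub>M M2) (\<lambda>p. f (fst p) * g (snd p))"
    by (rule integrable_unit_bounded[where B = 1])
      (use f g in \<open>auto simp: space_pair_measure intro: mult_le_one\<close>, unfold_locales)
  show "(\<integral>p. f (fst p) * g (snd p) \<partial>(M1 \<Otimes>\<^sub>M M2)) = (\<integral>x. f x \<partial>M1) * (\<integral>x. g x \<partial>M2)"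
    using integral_fst'[OF I] by simp
qed

lemma couplingsD:
  assumes "\<gamma> \<in> couplings \<mu> \<nu>"
  shows "sets \<gamma> = sets (\<mu> \<Otimes>\<^sub>M \<nu>)" "distr \<gamma> \<mu> fst = \<mu>" "distr \<gamma> \<nu> snd = \<nu>"
    "space \<gamma> = space \<mu> \<times> space \<nu>"
  using assms sets_eq_imp_space_eq[of \<gamma> "\<mu> \<Otimes>\<^sub>M \<nu>"]
  by (auto simp: couplings_def space_pair_measure)

lemma couplings_prob_space:
  assumes \<gamma>: "\<gamma> \<in> couplings \<mu> \<nu>" and "prob_space \<mu>"
  shows "prob_space \<gamma>"
proof
  interpret \<mu>: prob_space \<mu> by fact
  have "fst \<in> \<gamma> \<rightarrow>\<^sub>M \<mu>"
    using measurable_cong_sets[OF couplingsD(1)[OF \<gamma>] refl] measurable_fst by blast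
  then have "emeasure (distr \<gamma> \<mu> fst) (space \<mu>) = emeasure \<gamma> (space \<gamma>)"
    by (subst emeasure_distr) (auto intro!: arg_cong[where f = "emeasure \<gamma>"] simp: couplingsD(4)[OF \<gamma>])
  then show "emeasure \<gamma> (space \<gamma>) = 1"
    using couplingsD(2)[OF \<gamma>] \<mu>.emeasure_space_1 by simp
qed

lemma couplings_integral_marginals:
  fixes f :: "'b \<Rightarrow> real"
  assumes \<gamma>: "\<gamma> \<in> couplings \<mu> \<nu>"
  shows "f \<in> borel_measurable \<mu> \<Longrightarrow> (\<integral>p. f (fst p) \<partial>\<gamma>) = (\<integral>x. f x \<partial>\<mu>)"
    and "f \<in> borel_measurable \<nu> \<Longrightarrow> (\<integral>p. f (snd p) \<partial>\<gamma>) = (\<integral>x. f x \<partial>\<nu>)"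
proof -
  have m: "fst \<in> \<gamma> \<rightarrow>\<^sub>M \<mu>" "snd \<in> \<gamma> \<rightarrow>\<^sub>M \<nu>"
    using measurable_cong_sets[OF couplingsD(1)[OF \<gamma>] refl] measurable_fst measurable_snd by blast+
  show "(\<integral>p. f (fst p) \<partial>\<gamma>) = (\<integral>x. f x \<partial>\<mu>)" if "f \<in> borel_measurable \<mu>"
    using integral_distr[OF m(1) that] couplingsD(2)[OF \<gamma>] by simp
  show "(\<integral>p. f (snd p) \<partial>\<gamma>) = (\<integral>x. f x \<partial>\<nu>)" if "f \<in> borel_measurable \<nu>"
    using integral_distr[OF m(2) that] couplingsD(3)[OF \<gamma>] by simp
qed

lemma transport_cost_lower:
  assumes \<gamma>: "\<gamma> \<in> couplings \<mu> \<nu>"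
    and nn: "\<And>x y. x \<in> space \<mu> \<Longrightarrow> y \<in> space \<nu> \<Longrightarrow> 0 \<le> U x y"
  shows "transport_cost U \<mu> \<nu> \<le> (\<integral>p. U (fst p) (snd p) \<partial>\<gamma>)"
  unfolding transport_cost_def
proof (rule cINF_lower[OF _ \<gamma>])
  show "bdd_below ((\<lambda>\<gamma>. \<integral>p. U (fst p) (snd p) \<partial>\<gamma>) ` couplings \<mu> \<nu>)"
    by (rule bdd_belowI2[where m = 0], rule integral_nonneg_AE, rule AE_I2)
      (auto simp: couplingsD(4) nn)
qed

text \<open>If \<open>\<gamma>\<close> is a plan between the weights of a partition of unity \<open>\<phi>\<close> under \<open>\<mu>\<close> and \<open>\<nu>\<close>,
  then this density with respect to \<open>\<mu> \<Otimes> \<nu>\<close> spreads it out to a coupling of \<open>\<mu>\<close> and \<open>\<nu>\<close>.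
  Vanishing weights are harmless: the division yields \<open>0\<close>, and so does \<open>\<gamma>\<close>.\<close>

lemma spread_plan:
  fixes \<phi> :: "'i \<Rightarrow> 'b \<Rightarrow> real" and \<gamma> :: "'i \<Rightarrow> 'i \<Rightarrow> real"
  assumes \<mu>: "prob_space \<mu>" and \<nu>: "prob_space \<nu>" and sets: "sets \<nu> = sets \<mu>"
    and fin: "finite I"
    and \<phi>_meas: "\<And>i. i \<in> I \<Longrightarrow> \<phi> i \<in> borel_measurable \<mu>"
    and \<phi>_nn: "\<And>i x. i \<in> I \<Longrightarrow> x \<in> space \<mu> \<Longrightarrow> 0 \<le> \<phi> i x"
    and \<phi>_sum: "\<And>x. x \<in> space \<mu> \<Longrightarrow> (\<Sum>i\<in>I. \<phi> i x) = 1"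
    and m_def: "m = (\<lambda>i. \<integral>x. \<phi> i x \<partial>\<mu>)" and n_def: "n = (\<lambda>i. \<integral>x. \<phi> i x \<partial>\<nu>)"
    and \<gamma>: "\<And>i j. i \<in> I \<Longrightarrow> j \<in> I \<Longrightarrow> 0 \<le> \<gamma> i j"
    and row: "\<And>i. i \<in> I \<Longrightarrow> (\<Sum>j\<in>I. \<gamma> i j) = m i"
    and col: "\<And>j. j \<in> I \<Longrightarrow> (\<Sum>i\<in>I. \<gamma> i j) = n j"
    and \<rho>_def: "\<rho> = (\<lambda>p. \<Sum>i\<in>I. \<Sum>j\<in>I. \<gamma> i j / (m i * n j) * (\<phi> i (fst p) * \<phi> j (snd p)))"
  shows "density (\<mu> \<Otimes>\<^sub>M \<nu>) \<rho> \<in> couplings \<mu> \<nu>"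
proof -
  interpret \<mu>: prob_space \<mu> by fact
  interpret \<nu>: prob_space \<nu> by fact
  interpret pair_prob_space \<mu> \<nu> ..
  have sp: "space \<nu> = space \<mu>" using sets by (rule sets_eq_imp_space_eq)
  have \<phi>_meas': "\<phi> i \<in> borel_measurable \<nu>" if "i \<in> I" for i
    using \<phi>_meas[OF that] measurable_cong_sets[OF sets refl] by blast
  note [measurable] = \<phi>_meas \<phi>_meas'
  have \<phi>1: "\<phi> i x \<le> 1" if "i \<in> I" "x \<in> space \<mu>" for i x
    using member_le_sum[of i I "\<lambda>i. \<phi> i x"] fin that \<phi>_nn \<phi>_sum by auto
  have m_nn: "0 \<le> m i" if "i \<in> I" for i
    unfolding m_def using \<phi>_nn that by (intro integral_nonneg_AE AE_I2) auto
  have n_nn: "0 \<le> n i" if "i \<in> I" for i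
    unfolding n_def using \<phi>_nn that sp by (intro integral_nonneg_AE AE_I2) auto
  have \<rho>_meas[measurable]: "\<rho> \<in> borel_measurable (\<mu> \<Otimes>\<^sub>M \<nu>)"
    unfolding \<rho>_def by measurable
  have \<rho>_nn: "0 \<le> \<rho> p" if "p \<in> space (\<mu> \<Otimes>\<^sub>M \<nu>)" for p
    using that \<gamma> m_nn n_nn \<phi>_nn sp unfolding \<rho>_def
    by (intro sum_nonneg mult_nonneg_nonneg divide_nonneg_nonneg) (auto simp: space_pair_measure)
  define B where "B = (\<Sum>i\<in>I. \<Sum>j\<in>I. \<gamma> i j / (m i * n j))"
  have \<rho>B: "\<rho> p \<le> B" if p: "p \<in> space (\<mu> \<Otimes>\<^sub>M \<nu>)" for p
    unfolding \<rho>_def B_def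
  proof (intro sum_mono)
    fix i j assume ij: "i \<in> I" "j \<in> I"
    have "\<phi> i (fst p) * \<phi> j (snd p) \<le> 1"
      using ij p \<phi>_nn \<phi>1 sp by (intro mult_le_one) (auto simp: space_pair_measure)
    then show "\<gamma> i j / (m i * n j) * (\<phi> i (fst p) * \<phi> j (snd p)) \<le> \<gamma> i j / (m i * n j)"
      using ij \<gamma> m_nn n_nn by (intro mult_left_le) auto
  qed
  have \<gamma>_mn: "\<gamma> i j / (m i * n j) * (m i * n j) = \<gamma> i j" if ij: "i \<in> I" "j \<in> I" for i j
  proof -
    have "\<gamma> i j \<le> m i" "\<gamma> i j \<le> n j"
      unfolding row[OF ij(1), symmetric] col[OF ij(2), symmetric]
      using fin ij \<gamma> by (auto intro: member_le_sum[of j I "\<gamma> i"] member_le_sum[of i I "\<lambda>i. \<gamma> i j"])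
    then show ?thesis using \<gamma>[OF ij] by (cases "m i = 0 \<or> n j = 0") auto
  qed
  have int\<rho>: "integrable (\<mu> \<Otimes>\<^sub>M \<nu>) \<rho>"
    by (rule integrable_unit_bounded[OF _ _ \<rho>_nn \<rho>B]) (unfold_locales, simp_all)
  \<comment> \<open>Both marginals are instances, with an indicator as one factor and the constant 1
    as the other.\<close>
  have key: "(\<integral>p. \<rho> p * (f (fst p) * g (snd p)) \<partial>(\<mu> \<Otimes>\<^sub>M \<nu>)) =
      (\<Sum>i\<in>I. \<Sum>j\<in>I. \<gamma> i j / (m i * n j) * ((\<integral>x. \<phi> i x * f x \<partial>\<mu>) * (\<integral>x. \<phi> j x * g x \<partial>\<nu>)))"
    if [measurable]: "f \<in> borel_measurable \<mu>" "g \<in> borel_measurable \<nu>"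
      and f: "\<And>x. 0 \<le> f x" "\<And>x. f x \<le> 1" and g: "\<And>x. 0 \<le> g x" "\<And>x. g x \<le> 1" for f g :: "'b \<Rightarrow> real"
  proof -
    have *: "integrable (\<mu> \<Otimes>\<^sub>M \<nu>) (\<lambda>p. (\<phi> i (fst p) * f (fst p)) * (\<phi> j (snd p) * g (snd p)))"
      "(\<integral>p. (\<phi> i (fst p) * f (fst p)) * (\<phi> j (snd p) * g (snd p)) \<partial>(\<mu> \<Otimes>\<^sub>M \<nu>)) =
        (\<integral>x. \<phi> i x * f x \<partial>\<mu>) * (\<integral>x. \<phi> j x * g x \<partial>\<nu>)" if "i \<in> I" "j \<in> I" for i j
      using that f g \<phi>_nn \<phi>1 sp
      by (auto intro!: integral_product_factor[of "\<lambda>x. \<phi> i x * f x" "\<lambda>x. \<phi> j x * g x"] mult_le_one)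
    have "(\<integral>p. \<rho> p * (f (fst p) * g (snd p)) \<partial>(\<mu> \<Otimes>\<^sub>M \<nu>)) =
      (\<integral>p. (\<Sum>i\<in>I. \<Sum>j\<in>I. \<gamma> i j / (m i * n j) *
        ((\<phi> i (fst p) * f (fst p)) * (\<phi> j (snd p) * g (snd p)))) \<partial>(\<mu> \<Otimes>\<^sub>M \<nu>))"
      unfolding \<rho>_def sum_distrib_right by (simp add: mult_ac)
    also have "\<dots> = (\<Sum>i\<in>I. \<Sum>j\<in>I. \<gamma> i j / (m i * n j) *
        ((\<integral>x. \<phi> i x * f x \<partial>\<mu>) * (\<integral>x. \<phi> j x * g x \<partial>\<nu>)))"
      using * by (simp add: Bochner_Integration.integral_sum Bochner_Integration.integrable_sum cong: sum.cong)
    finally show ?thesis .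
  qed
  define \<Gamma> where "\<Gamma> = density (\<mu> \<Otimes>\<^sub>M \<nu>) \<rho>"
  have sets\<Gamma>: "sets \<Gamma> = sets (\<mu> \<Otimes>\<^sub>M \<nu>)" by (simp add: \<Gamma>_def)
  have m\<Gamma>: "fst \<in> \<Gamma> \<rightarrow>\<^sub>M \<mu>" "snd \<in> \<Gamma> \<rightarrow>\<^sub>M \<nu>"
    unfolding \<Gamma>_def by simp_all
  have fin\<Gamma>: "finite_measure \<Gamma>"
  proof
    have "emeasure \<Gamma> (space \<Gamma>) = (\<integral>\<^sup>+p. ennreal (\<rho> p) \<partial>(\<mu> \<Otimes>\<^sub>M \<nu>))"
      unfolding \<Gamma>_def by (subst emeasure_density) (auto intro!: nn_integral_cong)
    also have "\<dots> = ennreal (\<integral>p. \<rho> p \<partial>(\<mu> \<Otimes>\<^sub>M \<nu>))"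
      by (rule nn_integral_eq_integral[OF int\<rho>]) (use \<rho>_nn in auto)
    finally show "emeasure \<Gamma> (space \<Gamma>) \<noteq> \<infinity>" by simp
  qed
  interpret \<Gamma>: finite_measure \<Gamma> by fact
  have meas\<Gamma>: "measure \<Gamma> C = (\<integral>p. \<rho> p * indicator C p \<partial>(\<mu> \<Otimes>\<^sub>M \<nu>))" if C: "C \<in> sets \<Gamma>" for C
  proof -
    have "measure \<Gamma> C = (\<integral>p. indicator C p \<partial>\<Gamma>)" using C by simp
    also have "\<dots> = (\<integral>p. \<rho> p * indicator C p \<partial>(\<mu> \<Otimes>\<^sub>M \<nu>))"
      unfolding \<Gamma>_def using C sets\<Gamma> \<rho>_nn by (subst integral_density) auto
    finally show ?thesis .
  qed
  have le_m: "0 \<le> (\<integral>x. \<phi> i x * indicator A x \<partial>\<mu>)" "(\<integral>x. \<phi> i x * indicator A x \<partial>\<mu>) \<le> m i"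
    if "i \<in> I" "A \<in> sets \<mu>" for i A
  proof -
    show "0 \<le> (\<integral>x. \<phi> i x * indicator A x \<partial>\<mu>)"
      using that \<phi>_nn by (intro integral_nonneg_AE AE_I2) auto
    show "(\<integral>x. \<phi> i x * indicator A x \<partial>\<mu>) \<le> m i"
      unfolding m_def using that \<phi>_nn \<phi>1
      by (intro integral_mono integrable_unit_bounded[where B = 1])
        (auto split: split_indicator intro: \<mu>.finite_measure_axioms)
  qed
  have le_n: "0 \<le> (\<integral>x. \<phi> i x * indicator A x \<partial>\<nu>)" "(\<integral>x. \<phi> i x * indicator A x \<partial>\<nu>) \<le> n i"
    if "i \<in> I" "A \<in> sets \<nu>" for i A
  proof -
    show "0 \<le> (\<integral>x. \<phi> i x * indicator A x \<partial>\<nu>)"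
      using that \<phi>_nn sp by (intro integral_nonneg_AE AE_I2) auto
    show "(\<integral>x. \<phi> i x * indicator A x \<partial>\<nu>) \<le> n i"
      unfolding n_def using that \<phi>_nn \<phi>1 sp
      by (intro integral_mono integrable_unit_bounded[where B = 1])
        (auto split: split_indicator intro: \<nu>.finite_measure_axioms)
  qed
  have tot: "(\<Sum>i\<in>I. \<integral>x. \<phi> i x * indicator A x \<partial>\<mu>) = measure \<mu> A" if A: "A \<in> sets \<mu>" for A
  proof -
    have "(\<Sum>i\<in>I. \<integral>x. \<phi> i x * indicator A x \<partial>\<mu>) = (\<integral>x. (\<Sum>i\<in>I. \<phi> i x * indicator A x) \<partial>\<mu>)"
      using A \<phi>_nn \<phi>1
      by (intro Bochner_Integration.integral_sum[symmetric] integrable_unit_bounded[where B = 1])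
        (auto split: split_indicator intro: \<mu>.finite_measure_axioms)
    also have "\<dots> = (\<integral>x. indicator A x \<partial>\<mu>)"
      by (intro Bochner_Integration.integral_cong) (auto simp: sum_distrib_right[symmetric] \<phi>_sum)
    also have "\<dots> = measure \<mu> A" using A by simp
    finally show ?thesis .
  qed
  have tot': "(\<Sum>i\<in>I. \<integral>x. \<phi> i x * indicator A x \<partial>\<nu>) = measure \<nu> A" if A: "A \<in> sets \<nu>" for A
  proof -
    have "(\<Sum>i\<in>I. \<integral>x. \<phi> i x * indicator A x \<partial>\<nu>) = (\<integral>x. (\<Sum>i\<in>I. \<phi> i x * indicator A x) \<partial>\<nu>)"
      using A \<phi>_nn \<phi>1 sp
      by (intro Bochner_Integration.integral_sum[symmetric] integrable_unit_bounded[where B = 1])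
        (auto split: split_indicator intro: \<nu>.finite_measure_axioms)
    also have "\<dots> = (\<integral>x. indicator A x \<partial>\<nu>)"
      by (intro Bochner_Integration.integral_cong) (auto simp: sum_distrib_right[symmetric] \<phi>_sum sp)
    also have "\<dots> = measure \<nu> A" using A by simp
    finally show ?thesis .
  qed
  have "distr \<Gamma> \<mu> fst = \<mu>"
  proof (rule measure_eqI)
    fix A assume "A \<in> sets (distr \<Gamma> \<mu> fst)"
    then have A[measurable]: "A \<in> sets \<mu>" by simp
    define C where "C = fst -` A \<inter> space \<Gamma>"
    have C: "C \<in> sets \<Gamma>" unfolding C_def using m\<Gamma>(1) A by (rule measurable_sets)
    have "measure \<Gamma> C = (\<integral>p. \<rho> p * (indicator A (fst p) * 1) \<partial>(\<mu> \<Otimes>\<^sub>M \<nu>))"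
      unfolding meas\<Gamma>[OF C]
      by (intro Bochner_Integration.integral_cong) (auto simp: C_def \<Gamma>_def split: split_indicator)
    also have "\<dots> = (\<Sum>i\<in>I. \<Sum>j\<in>I. \<gamma> i j / (m i * n j) * ((\<integral>x. \<phi> i x * indicator A x \<partial>\<mu>) * n j))"
      by (subst key) (auto simp: n_def)
    also have "\<dots> = (\<Sum>i\<in>I. \<integral>x. \<phi> i x * indicator A x \<partial>\<mu>)"
    proof (rule sum.cong[OF refl])
      fix i assume i: "i \<in> I"
      define a where "a = (\<integral>x. \<phi> i x * indicator A x \<partial>\<mu>)"
      have a: "0 \<le> a" "a \<le> m i" using le_m[OF i A] by (auto simp: a_def)
      show "(\<Sum>j\<in>I. \<gamma> i j / (m i * n j) * (a * n j)) = a"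
      \<comment> \<open>For \<open>m i = 0\<close> the left side vanishes by the convention on
        division, and \<open>a\<close> vanishes because it is squeezed between 0 and
        \<open>m i\<close>.\<close>
      proof (cases "m i = 0")
        case False
        have "\<gamma> i j / (m i * n j) * (a * n j) = \<gamma> i j * (a / m i)" if "j \<in> I" for j
          using \<gamma>_mn[OF i that] False by (cases "n j = 0") (auto simp: field_simps)
        then have "(\<Sum>j\<in>I. \<gamma> i j / (m i * n j) * (a * n j)) = m i * (a / m i)"
          by (simp only: sum_distrib_right[symmetric] row[OF i] cong: sum.cong)
        then show ?thesis using False by simp
      qed (use a in simp)
    qed
    also have "\<dots> = measure \<mu> A" by (rule tot[OF A])
    finally show "emeasure (distr \<Gamma> \<mu> fst) A = emeasure \<mu> A"
      by (subst emeasure_distr[OF m\<Gamma>(1) A])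
        (simp add: C_def[symmetric] \<Gamma>.emeasure_eq_measure \<mu>.emeasure_eq_measure)
  qed simp
  moreover have "distr \<Gamma> \<nu> snd = \<nu>"
  proof (rule measure_eqI)
    fix A assume "A \<in> sets (distr \<Gamma> \<nu> snd)"
    then have A[measurable]: "A \<in> sets \<nu>" by simp
    define C where "C = snd -` A \<inter> space \<Gamma>"
    have C: "C \<in> sets \<Gamma>" unfolding C_def using m\<Gamma>(2) A by (rule measurable_sets)
    have "measure \<Gamma> C = (\<integral>p. \<rho> p * (1 * indicator A (snd p)) \<partial>(\<mu> \<Otimes>\<^sub>M \<nu>))"
      unfolding meas\<Gamma>[OF C]
      by (intro Bochner_Integration.integral_cong) (auto simp: C_def \<Gamma>_def split: split_indicator)
    also have "\<dots> = (\<Sum>i\<in>I. \<Sum>j\<in>I. \<gamma> i j / (m i * n j) * (m i * (\<integral>x. \<phi> j x * indicator A x \<partial>\<nu>)))"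
      by (subst key) (auto simp: m_def)
    also have "\<dots> = (\<Sum>j\<in>I. \<Sum>i\<in>I. \<gamma> i j / (m i * n j) * (m i * (\<integral>x. \<phi> j x * indicator A x \<partial>\<nu>)))"
      by (rule sum.swap)
    also have "\<dots> = (\<Sum>j\<in>I. \<integral>x. \<phi> j x * indicator A x \<partial>\<nu>)"
    proof (rule sum.cong[OF refl])
      fix j assume j: "j \<in> I"
      define a where "a = (\<integral>x. \<phi> j x * indicator A x \<partial>\<nu>)"
      have a: "0 \<le> a" "a \<le> n j" using le_n[OF j A] by (auto simp: a_def)
      show "(\<Sum>i\<in>I. \<gamma> i j / (m i * n j) * (m i * a)) = a"
      proof (cases "n j = 0")
        case False
        have "\<gamma> i j / (m i * n j) * (m i * a) = \<gamma> i j * (a / n j)" if "i \<in> I" for i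
          using \<gamma>_mn[OF that j] False by (cases "m i = 0") (auto simp: field_simps)
        then have "(\<Sum>i\<in>I. \<gamma> i j / (m i * n j) * (m i * a)) = n j * (a / n j)"
          by (simp only: sum_distrib_right[symmetric] col[OF j] cong: sum.cong)
        then show ?thesis using False by simp
      qed (use a in simp)
    qed
    also have "\<dots> = measure \<nu> A" by (rule tot'[OF A])
    finally show "emeasure (distr \<Gamma> \<nu> snd) A = emeasure \<nu> A"
      by (subst emeasure_distr[OF m\<Gamma>(2) A])
        (simp add: C_def[symmetric] \<Gamma>.emeasure_eq_measure \<nu>.emeasure_eq_measure)
  qed simp
  ultimately show ?thesis
    using sets\<Gamma> by (simp add: couplings_def \<Gamma>_def[symmetric])
qed

text \<open>The spread-out coupling pairs piece \<open>i\<close> with piece \<open>j\<close> with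
  total mass \<open>\<gamma> i j\<close> and pays there at most the distance of the centres plus
  both radii. The radii may differ, so that one piece can collect whatever no small ball catches, at
  the trivial radius 1. The potential \<open>h\<close> is part of the result since it is used in two
  ways: imitated by a formula to obtain duality, and merely bounded by 1 to obtain
  continuity.\<close>

lemma transport_cost_le_partition:
  fixes \<phi> :: "'i \<Rightarrow> 'b \<Rightarrow> real" and U :: "'b \<Rightarrow> 'b \<Rightarrow> real"
  assumes \<mu>: "prob_space \<mu>" and \<nu>: "prob_space \<nu>" and sets: "sets \<nu> = sets \<mu>"
    and U_meas: "(\<lambda>p. U (fst p) (snd p)) \<in> borel_measurable (\<mu> \<Otimes>\<^sub>M \<nu>)"
    and U0: "\<And>x. U x x = 0" and Usym: "\<And>x y. U x y = U y x"
    and Utri: "\<And>x y z. U x z \<le> U x y + U y z"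
    and Unn: "\<And>x y. 0 \<le> U x y" and U1: "\<And>x y. U x y \<le> 1"
    and fin: "finite I"
    and \<phi>_meas: "\<And>i. i \<in> I \<Longrightarrow> \<phi> i \<in> borel_measurable \<mu>"
    and \<phi>_nn: "\<And>i x. i \<in> I \<Longrightarrow> x \<in> space \<mu> \<Longrightarrow> 0 \<le> \<phi> i x"
    and \<phi>_sum: "\<And>x. x \<in> space \<mu> \<Longrightarrow> (\<Sum>i\<in>I. \<phi> i x) = 1"
    and e: "\<And>i x. i \<in> I \<Longrightarrow> x \<in> space \<mu> \<Longrightarrow> \<phi> i x \<noteq> 0 \<Longrightarrow> U x (z i) \<le> e i"
    and m_def: "m = (\<lambda>i. \<integral>x. \<phi> i x \<partial>\<mu>)" and n_def: "n = (\<lambda>i. \<integral>x. \<phi> i x \<partial>\<nu>)"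
    and \<delta>: "0 < \<delta>"
  obtains h where "\<And>i j. i \<in> I \<Longrightarrow> j \<in> I \<Longrightarrow> \<bar>h i - h j\<bar> \<le> U (z i) (z j)"
    and "\<And>i. i \<in> I \<Longrightarrow> 0 \<le> h i" and "\<And>i. i \<in> I \<Longrightarrow> h i \<le> 1"
    and "transport_cost U \<mu> \<nu> \<le> (\<Sum>i\<in>I. h i * (m i - n i)) + (\<Sum>i\<in>I. e i * (m i + n i)) + \<delta>"
proof -
  interpret \<mu>: prob_space \<mu> by fact
  interpret \<nu>: prob_space \<nu> by fact
  interpret pair_prob_space \<mu> \<nu> ..
  have sp: "space \<nu> = space \<mu>" using sets by (rule sets_eq_imp_space_eq)
  have \<phi>_meas': "\<phi> i \<in> borel_measurable \<nu>" if "i \<in> I" for i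
    using \<phi>_meas[OF that] measurable_cong_sets[OF sets refl] by blast
  note [measurable] = \<phi>_meas \<phi>_meas' U_meas
  have \<phi>1: "\<phi> i x \<le> 1" if "i \<in> I" "x \<in> space \<mu>" for i x
    using member_le_sum[of i I "\<lambda>i. \<phi> i x"] fin that \<phi>_nn \<phi>_sum by auto
  have int\<phi>: "integrable \<mu> (\<phi> i)" "integrable \<nu> (\<phi> i)" if "i \<in> I" for i
    using that \<phi>_nn \<phi>1 sp
    by (auto intro!: integrable_unit_bounded[where B = 1] \<mu>.finite_measure_axioms \<nu>.finite_measure_axioms)
  have m: "0 \<le> m i" if "i \<in> I" for i
    unfolding m_def using \<phi>_nn that by (intro integral_nonneg_AE AE_I2) auto
  have n: "0 \<le> n i" if "i \<in> I" for i
    unfolding n_def using \<phi>_nn that sp by (intro integral_nonneg_AE AE_I2) auto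
  have "sum m I = (\<integral>x. (\<Sum>i\<in>I. \<phi> i x) \<partial>\<mu>)"
    unfolding m_def using int\<phi> by (simp add: Bochner_Integration.integral_sum)
  also have "\<dots> = (\<integral>x. 1 \<partial>\<mu>)" by (intro Bochner_Integration.integral_cong) (auto simp: \<phi>_sum)
  finally have msum: "sum m I = 1" by (simp add: \<mu>.prob_space)
  have "sum n I = (\<integral>x. (\<Sum>i\<in>I. \<phi> i x) \<partial>\<nu>)"
    unfolding n_def using int\<phi> by (simp add: Bochner_Integration.integral_sum)
  also have "\<dots> = (\<integral>x. 1 \<partial>\<nu>)" by (intro Bochner_Integration.integral_cong) (auto simp: \<phi>_sum sp)
  finally have nsum: "sum n I = 1" by (simp add: \<nu>.prob_space)
  have ne: "I \<noteq> {}" using msum by auto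
  show thesis
  proof (rule finite_kantorovich[of I "\<lambda>i j. U (z i) (z j)" m n \<delta>])
    fix \<gamma> h
    assume \<gamma>: "\<And>i j. i \<in> I \<Longrightarrow> j \<in> I \<Longrightarrow> 0 \<le> \<gamma> i j"
      and row: "\<And>i. i \<in> I \<Longrightarrow> (\<Sum>j\<in>I. \<gamma> i j) = m i"
      and col: "\<And>j. j \<in> I \<Longrightarrow> (\<Sum>i\<in>I. \<gamma> i j) = n j"
      and cost: "(\<Sum>i\<in>I. \<Sum>j\<in>I. \<gamma> i j * U (z i) (z j)) \<le> (\<Sum>i\<in>I. h i * (m i - n i)) + \<delta>"
      and h: "\<And>i j. i \<in> I \<Longrightarrow> j \<in> I \<Longrightarrow> \<bar>h i - h j\<bar> \<le> U (z i) (z j)"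
        "\<And>i. i \<in> I \<Longrightarrow> 0 \<le> h i" "\<And>i. i \<in> I \<Longrightarrow> h i \<le> 1"
    define \<rho> where "\<rho> = (\<lambda>p. \<Sum>i\<in>I. \<Sum>j\<in>I. \<gamma> i j / (m i * n j) * (\<phi> i (fst p) * \<phi> j (snd p)))"
    have \<rho>_meas[measurable]: "\<rho> \<in> borel_measurable (\<mu> \<Otimes>\<^sub>M \<nu>)"
      unfolding \<rho>_def by measurable
    have coef: "0 \<le> \<gamma> i j / (m i * n j)" if "i \<in> I" "j \<in> I" for i j
      using that \<gamma> m n by auto
    have \<rho>_nn: "0 \<le> \<rho> p" if "p \<in> space (\<mu> \<Otimes>\<^sub>M \<nu>)" for p
      using that coef \<phi>_nn sp unfolding \<rho>_def
      by (intro sum_nonneg mult_nonneg_nonneg) (auto simp: space_pair_measure)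
    have \<gamma>_mn: "\<gamma> i j / (m i * n j) * (m i * n j) = \<gamma> i j" if ij: "i \<in> I" "j \<in> I" for i j
    proof -
      have "\<gamma> i j \<le> m i" "\<gamma> i j \<le> n j"
        unfolding row[OF ij(1), symmetric] col[OF ij(2), symmetric]
        using fin ij \<gamma> by (auto intro: member_le_sum[of j I "\<gamma> i"] member_le_sum[of i I "\<lambda>i. \<gamma> i j"])
      then show ?thesis using \<gamma>[OF ij] by (cases "m i = 0 \<or> n j = 0") auto
    qed
    define \<Gamma> where "\<Gamma> = density (\<mu> \<Otimes>\<^sub>M \<nu>) \<rho>"
    have \<Gamma>: "\<Gamma> \<in> couplings \<mu> \<nu>"
      unfolding \<Gamma>_def
      by (rule spread_plan[OF \<mu> \<nu> sets fin \<phi>_meas \<phi>_nn \<phi>_sum m_def n_def \<gamma> row col \<rho>_def])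
    \<comment> \<open>An integrable majorant of \<rho> times the cost, valid term by term: a term
      with a vanishing factor \<phi> is 0 on both sides, and otherwise both radius bounds are
      available.\<close>
    define \<theta> where "\<theta> = (\<lambda>p. \<Sum>i\<in>I. \<Sum>j\<in>I. \<gamma> i j / (m i * n j) * (U (z i) (z j) + e i + e j) *
        (\<phi> i (fst p) * \<phi> j (snd p)))"
    have prod: "integrable (\<mu> \<Otimes>\<^sub>M \<nu>) (\<lambda>p. \<phi> i (fst p) * \<phi> j (snd p))"
      "(\<integral>p. \<phi> i (fst p) * \<phi> j (snd p) \<partial>(\<mu> \<Otimes>\<^sub>M \<nu>)) = m i * n j" if "i \<in> I" "j \<in> I" for i j
      using that \<phi>_nn \<phi>1 sp
      by (auto simp: m_def n_def intro!: integral_product_factor[of "\<phi> i" "\<phi> j"])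
    have int\<theta>: "integrable (\<mu> \<Otimes>\<^sub>M \<nu>) \<theta>"
      unfolding \<theta>_def using prod
      by (intro Bochner_Integration.integrable_sum integrable_mult_right) auto
    have U\<theta>: "\<rho> p * U (fst p) (snd p) \<le> \<theta> p" if p: "p \<in> space (\<mu> \<Otimes>\<^sub>M \<nu>)" for p
      unfolding \<rho>_def \<theta>_def sum_distrib_right
    proof (intro sum_mono)
      fix i j assume ij: "i \<in> I" "j \<in> I"
      have sp': "fst p \<in> space \<mu>" "snd p \<in> space \<mu>"
        using p unfolding space_pair_measure sp by (simp_all add: mem_Times_iff)
      show "\<gamma> i j / (m i * n j) * (\<phi> i (fst p) * \<phi> j (snd p)) * U (fst p) (snd p)
        \<le> \<gamma> i j / (m i * n j) * (U (z i) (z j) + e i + e j) * (\<phi> i (fst p) * \<phi> j (snd p))"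
      proof (cases "\<phi> i (fst p) = 0 \<or> \<phi> j (snd p) = 0")
        case False
        have "U (fst p) (snd p) \<le> U (fst p) (z i) + (U (z i) (z j) + U (z j) (snd p))"
          using Utri[of "fst p" "snd p" "z i"] Utri[of "z i" "snd p" "z j"] by linarith
        also have "\<dots> \<le> U (z i) (z j) + e i + e j"
        proof -
          have "U (fst p) (z i) \<le> e i" using e[OF ij(1) sp'(1)] False by blast
          moreover have "U (z j) (snd p) \<le> e j"
            unfolding Usym[of "z j" "snd p"] using e[OF ij(2) sp'(2)] False by blast
          ultimately show ?thesis by linarith
        qed
        finally have "(\<gamma> i j / (m i * n j) * (\<phi> i (fst p) * \<phi> j (snd p))) * U (fst p) (snd p) \<le>
            (\<gamma> i j / (m i * n j) * (\<phi> i (fst p) * \<phi> j (snd p))) * (U (z i) (z j) + e i + e j)"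
          by (intro mult_left_mono mult_nonneg_nonneg coef[OF ij] \<phi>_nn ij sp')
        then show ?thesis by (simp only: mult_ac)
      qed (elim disjE; simp)
    qed
    have "transport_cost U \<mu> \<nu> \<le> (\<integral>p. U (fst p) (snd p) \<partial>\<Gamma>)"
      by (rule transport_cost_lower[OF \<Gamma> Unn])
    also have "\<dots> = (\<integral>p. \<rho> p * U (fst p) (snd p) \<partial>(\<mu> \<Otimes>\<^sub>M \<nu>))"
      unfolding \<Gamma>_def using \<rho>_nn by (subst integral_density) auto
    also have "\<dots> \<le> (\<integral>p. \<theta> p \<partial>(\<mu> \<Otimes>\<^sub>M \<nu>))"
    proof (rule integral_mono_AE[OF _ int\<theta>])
      show "integrable (\<mu> \<Otimes>\<^sub>M \<nu>) (\<lambda>p. \<rho> p * U (fst p) (snd p))"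
        by (rule Bochner_Integration.integrable_bound[OF int\<theta>])
          (use U\<theta> \<rho>_nn Unn in \<open>auto intro!: AE_I2 intro: order_trans[OF _ abs_ge_self]\<close>)
    qed (use U\<theta> in auto)
    also have "\<dots> = (\<Sum>i\<in>I. \<Sum>j\<in>I. \<gamma> i j / (m i * n j) * (U (z i) (z j) + e i + e j) * (m i * n j))"
      unfolding \<theta>_def using prod
      by (simp add: Bochner_Integration.integral_sum Bochner_Integration.integrable_sum cong: sum.cong)
    also have "\<dots> = (\<Sum>i\<in>I. \<Sum>j\<in>I. \<gamma> i j * (U (z i) (z j) + e i + e j))"
    proof (intro sum.cong refl)
      fix i j assume ij: "i \<in> I" "j \<in> I"
      have "\<gamma> i j / (m i * n j) * (U (z i) (z j) + e i + e j) * (m i * n j) =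
          (\<gamma> i j / (m i * n j) * (m i * n j)) * (U (z i) (z j) + e i + e j)" by (simp only: mult_ac)
      then show "\<gamma> i j / (m i * n j) * (U (z i) (z j) + e i + e j) * (m i * n j) =
          \<gamma> i j * (U (z i) (z j) + e i + e j)" by (simp only: \<gamma>_mn[OF ij])
    qed
    also have "\<dots> = (\<Sum>i\<in>I. \<Sum>j\<in>I. \<gamma> i j * U (z i) (z j)) + (\<Sum>i\<in>I. e i * m i) + (\<Sum>j\<in>I. e j * n j)"
    proof -
      have "(\<Sum>i\<in>I. \<Sum>j\<in>I. \<gamma> i j * e i) = (\<Sum>i\<in>I. e i * m i)"
        by (intro sum.cong) (simp_all add: sum_distrib_right[symmetric] row)
      moreover have "(\<Sum>i\<in>I. \<Sum>j\<in>I. \<gamma> i j * e j) = (\<Sum>j\<in>I. e j * n j)"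
        by (subst sum.swap, intro sum.cong) (simp_all add: sum_distrib_right[symmetric] col)
      ultimately show ?thesis by (simp add: distrib_left sum.distrib)
    qed
    finally have "transport_cost U \<mu> \<nu> \<le>
        (\<Sum>i\<in>I. h i * (m i - n i)) + (\<Sum>i\<in>I. e i * (m i + n i)) + \<delta>"
      using cost by (simp add: distrib_left sum.distrib)
    then show thesis using that h by blast
  qed (rule fin ne U0 Usym Utri Unn U1 m n msum nsum \<delta>; assumption)+
qed


section \<open>The discounted uniform pseudometric on trajectories\<close>

text \<open>The properties of \<open>d n\<close> that the induction carries along. Distinct states
  may have distance 0, and \<open>m\<close> need not generate the topology of the state space; joint
  continuity is the only link between the two.\<close>

locale discounted_pseudometric =
  fixes m :: "'a::polish_space \<Rightarrow> 'a \<Rightarrow> real" and c :: real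
  assumes c0: "0 < c" and c1: "c < 1"
    and refl: "m x x = 0" and sym: "m x y = m y x" and tri: "m x z \<le> m x y + m y z"
    and nonneg: "0 \<le> m x y" and le1: "m x y \<le> 1"
    and cont: "continuous_on UNIV (\<lambda>p. m (fst p) (snd p))"
begin

abbreviation "U \<equiv> disc_unif_dist c m"

lemma powr_le1: "0 \<le> t \<Longrightarrow> c powr t \<le> 1"
  using powr_mono'[of 0 t c] c0 c1 by simp

lemma term_le1: "0 \<le> t \<Longrightarrow> c powr t * m x y \<le> 1"
  using powr_le1[of t] nonneg le1 by (simp add: mult_le_one)

lemma U_upper: "0 \<le> t \<Longrightarrow> c powr t * m (\<omega> t) (\<omega>' t) \<le> U \<omega> \<omega>'"
  unfolding disc_unif_dist_def
  by (rule cSUP_upper) (auto intro!: bdd_aboveI2[where M = 1] term_le1)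

lemma U_least: "(\<And>t. 0 \<le> t \<Longrightarrow> c powr t * m (\<omega> t) (\<omega>' t) \<le> B) \<Longrightarrow> U \<omega> \<omega>' \<le> B"
  unfolding disc_unif_dist_def by (rule cSUP_least) auto

lemma U_start: "m (\<omega> 0) (\<omega>' 0) \<le> U \<omega> \<omega>'"
  using U_upper[of 0 \<omega> \<omega>'] c0 by simp

lemma U_nonneg: "0 \<le> U \<omega> \<omega>'"
  using U_start[of \<omega> \<omega>'] nonneg[of "\<omega> 0" "\<omega>' 0"] by linarith

lemma U_le1: "U \<omega> \<omega>' \<le> 1"
  by (rule U_least) (rule term_le1)

lemma U_refl: "U \<omega> \<omega> = 0"
  by (simp add: disc_unif_dist_def refl)

lemma U_sym: "U \<omega> \<omega>' = U \<omega>' \<omega>"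
  by (simp add: disc_unif_dist_def sym)

lemma U_tri: "U \<omega> \<omega>'' \<le> U \<omega> \<omega>' + U \<omega>' \<omega>''"
proof (rule U_least)
  fix t :: real assume t: "0 \<le> t"
  have "c powr t * m (\<omega> t) (\<omega>'' t) \<le> c powr t * (m (\<omega> t) (\<omega>' t) + m (\<omega>' t) (\<omega>'' t))"
    using tri by (intro mult_left_mono) auto
  then show "c powr t * m (\<omega> t) (\<omega>'' t) \<le> U \<omega> \<omega>' + U \<omega>' \<omega>''"
    using U_upper[OF t, of \<omega> \<omega>'] U_upper[OF t, of \<omega>' \<omega>''] by (simp add: distrib_left)
qed

lemma U_diff: "\<bar>U \<omega> \<zeta> - U \<omega>' \<zeta>\<bar> \<le> U \<omega> \<omega>'"
  using U_tri[of \<omega> \<zeta> \<omega>'] U_tri[of \<omega>' \<zeta> \<omega>] U_sym[of \<omega> \<omega>'] by linarith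

lemma continuous_on_m:
  assumes "continuous_on S f" "continuous_on S g"
  shows "continuous_on S (\<lambda>x. m (f x) (g x))"
  using continuous_on_compose2[OF cont continuous_on_Pair[OF assms]] by simp

lemma discount_tail:
  assumes "0 < e" obtains T where "0 < T" "\<And>t. T \<le> t \<Longrightarrow> c powr t \<le> e"
proof -
  have "((\<lambda>t. c powr t) \<longlongrightarrow> 0) at_top"
    using c0 c1 by real_asymp
  then have "\<forall>\<^sub>F t in at_top. c powr t < e"
    using assms by (rule order_tendstoD)
  then obtain T where "\<And>t. T \<le> t \<Longrightarrow> c powr t < e"
    unfolding eventually_at_top_linorder by blast
  then show thesis by (intro that[of "max T 1"]) (auto intro: less_imp_le)
qed

lemma U_le_tail:
  assumes "0 \<le> e" "\<And>t. 0 \<le> t \<Longrightarrow> t \<le> T \<Longrightarrow> m (\<omega> t) (\<omega>' t) \<le> e" "\<And>t. T \<le> t \<Longrightarrow> c powr t \<le> e"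
  shows "U \<omega> \<omega>' \<le> e"
proof (rule U_least)
  fix t :: real assume t: "0 \<le> t"
  show "c powr t * m (\<omega> t) (\<omega>' t) \<le> e"
  proof (cases "t \<le> T")
    case True
    have "c powr t * m (\<omega> t) (\<omega>' t) \<le> 1 * m (\<omega> t) (\<omega>' t)"
      using t powr_le1 nonneg by (intro mult_right_mono) auto
    then show ?thesis using assms(2)[OF t True] by simp
  next
    case False
    have "c powr t * m (\<omega> t) (\<omega>' t) \<le> c powr t * 1"
      using le1 by (intro mult_left_mono) auto
    then show ?thesis using assms(3)[of t] False by simp
  qed
qed

lemma trajectory_continuous: "\<omega> \<in> trajectories \<Longrightarrow> continuous_on {0..} \<omega>"
  by (simp add: trajectories_def)

text \<open>Along two continuous trajectories the discounted distance is continuous in time, so its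
  supremum is approached at rational times. This serves twice: it makes \<open>U\<close> a countable
  supremum, hence measurable, and formulas can evaluate only at rational times.\<close>

lemma U_rational_witness:
  assumes \<omega>: "\<omega> \<in> trajectories" and \<omega>': "\<omega>' \<in> trajectories" and B: "B < U \<omega> \<omega>'"
  obtains q :: rat where "0 \<le> q" "B < c powr of_rat q * m (\<omega> (of_rat q)) (\<omega>' (of_rat q))"
proof -
  define F where "F t = c powr t * m (\<omega> t) (\<omega>' t)" for t
  obtain t where t: "0 \<le> t" "B < F t"
    using B U_least[of \<omega> \<omega>' B] unfolding F_def by (meson not_less)
  have "continuous_on {0..} F"
    unfolding F_def using c0
    by (intro continuous_intros continuous_on_m trajectory_continuous \<omega> \<omega>') auto
  then obtain d where d: "0 < d" "\<And>s. 0 \<le> s \<Longrightarrow> dist s t < d \<Longrightarrow> dist (F s) (F t) < F t - B"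
    using t unfolding continuous_on_iff by (metis atLeast_iff diff_gt_0_iff_gt)
  \<comment> \<open>Taken to the right of \<open>t\<close>, so that it is non-negative even for
    \<open>t = 0\<close>.\<close>
  obtain q :: rat where q: "t < of_rat q" "of_rat q < t + d"
    using of_rat_dense[of t "t + d"] d by auto
  show thesis
  proof (rule that[of q])
    have q0: "0 < (of_rat q :: real)" using q t by linarith
    then show "0 \<le> q" by (metis less_imp_le zero_less_of_rat_iff)
    have "dist (of_rat q) t < d" using q t by (auto simp: dist_real_def)
    then have "dist (F (of_rat q)) (F t) < F t - B" using d(2) q0 by simp
    then show "B < c powr of_rat q * m (\<omega> (of_rat q)) (\<omega>' (of_rat q))"
      unfolding F_def[symmetric] by (simp add: dist_real_def)
  qed
qed

lemma space_traj_algebra: "space (traj_algebra :: (real \<Rightarrow> 'a) measure) = trajectories"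
  unfolding traj_algebra_def by (rule space_measure_of) auto

lemma measurable_eval:
  assumes "0 \<le> t" shows "(\<lambda>\<omega>. \<omega> t) \<in> (traj_algebra :: (real \<Rightarrow> 'a) measure) \<rightarrow>\<^sub>M borel"
proof (rule measurableI)
  fix A :: "'a set" assume "A \<in> sets borel"
  then have "{\<omega> \<in> trajectories. \<omega> t \<in> A} \<in> sets traj_algebra"
    unfolding traj_algebra_def using assms by (intro sets_measure_of[THEN equalityD2, THEN subsetD] sigma_sets.Basic) auto
  moreover have "(\<lambda>\<omega>. \<omega> t) -` A \<inter> space traj_algebra = {\<omega> \<in> trajectories. \<omega> t \<in> A}"
    by (auto simp: space_traj_algebra)
  ultimately show "(\<lambda>\<omega>. \<omega> t) -` A \<inter> space traj_algebra \<in> sets traj_algebra" by simp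
qed simp

lemma measurable_U:
  "(\<lambda>p. U (fst p) (snd p)) \<in> borel_measurable (traj_algebra \<Otimes>\<^sub>M traj_algebra)"
proof -
  define F where "F q p = c powr real_of_rat q * m (fst p (real_of_rat q)) (snd p (real_of_rat q))"
    for q and p :: "(real \<Rightarrow> 'a) \<times> (real \<Rightarrow> 'a)"
  have "(\<lambda>p. SUP q\<in>{q::rat. 0 \<le> q}. F q p) \<in> borel_measurable (traj_algebra \<Otimes>\<^sub>M traj_algebra)"
  proof (rule borel_measurable_cSUP)
    fix q :: rat assume q: "q \<in> {q. 0 \<le> q}"
    have m: "(\<lambda>p. m (fst p) (snd p)) \<in> borel_measurable (borel \<Otimes>\<^sub>M borel)"
      using borel_measurable_continuous_onI[OF cont] by (simp add: borel_prod)
    have q': "0 \<le> real_of_rat q" using q by simp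
    note e = measurable_eval[OF q']
    have "(\<lambda>p. (fst p (real_of_rat q), snd p (real_of_rat q)))
        \<in> (traj_algebra :: (real \<Rightarrow> 'a) measure) \<Otimes>\<^sub>M (traj_algebra :: (real \<Rightarrow> 'a) measure)
          \<rightarrow>\<^sub>M borel \<Otimes>\<^sub>M borel"
      by (rule measurable_Pair) (rule measurable_compose[OF measurable_fst e]
          measurable_compose[OF measurable_snd e])+
    from measurable_compose[OF this m]
    have "(\<lambda>p. m (fst p (real_of_rat q)) (snd p (real_of_rat q)))
        \<in> borel_measurable (traj_algebra \<Otimes>\<^sub>M traj_algebra)" by (simp only: fst_conv snd_conv)
    then show "F q \<in> borel_measurable (traj_algebra \<Otimes>\<^sub>M traj_algebra)"
      unfolding F_def by (intro borel_measurable_times borel_measurable_const)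
  next
    show "bdd_above ((\<lambda>q. F q p) ` {q. 0 \<le> q})" for p
      by (auto intro!: bdd_aboveI2[where M = 1] term_le1 simp: F_def)
  qed auto
  moreover have "U (fst p) (snd p) = (SUP q\<in>{q::rat. 0 \<le> q}. F q p)"
    if p: "p \<in> space (traj_algebra \<Otimes>\<^sub>M traj_algebra)" for p
  proof (rule antisym)
    have bdd: "bdd_above ((\<lambda>q. F q p) ` {q. 0 \<le> q})"
      by (auto intro!: bdd_aboveI2[where M = 1] term_le1 simp: F_def)
    show "(SUP q\<in>{q::rat. 0 \<le> q}. F q p) \<le> U (fst p) (snd p)"
      by (rule cSUP_least) (auto simp: F_def intro!: U_upper)
    show "U (fst p) (snd p) \<le> (SUP q\<in>{q::rat. 0 \<le> q}. F q p)"
    proof (rule ccontr)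
      assume "\<not> ?thesis"
      then have less: "(SUP q\<in>{q::rat. 0 \<le> q}. F q p) < U (fst p) (snd p)" by simp
      have traj: "fst p \<in> trajectories" "snd p \<in> trajectories"
        using p by (auto simp: space_pair_measure space_traj_algebra)
      obtain q :: rat where "0 \<le> q" "(SUP q\<in>{q::rat. 0 \<le> q}. F q p) <
          c powr of_rat q * m (fst p (of_rat q)) (snd p (of_rat q))"
        by (rule U_rational_witness[OF traj less])
      then have "0 \<le> q" "(SUP q\<in>{q::rat. 0 \<le> q}. F q p) < F q p" by (simp_all add: F_def)
      then show False using cSUP_upper[OF _ bdd, of q] by simp
    qed
  qed
  ultimately show ?thesis by (simp cong: measurable_cong)
qed

lemma measurable_U_section:
  assumes "z \<in> trajectories" shows "(\<lambda>\<omega>. U \<omega> z) \<in> borel_measurable traj_algebra"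
proof -
  have "(\<lambda>\<omega>. (\<omega>, z)) \<in> traj_algebra \<rightarrow>\<^sub>M (traj_algebra \<Otimes>\<^sub>M traj_algebra)"
    using assms by (intro measurable_Pair measurable_ident_sets) (auto simp: space_traj_algebra)
  from measurable_compose[OF this measurable_U] show ?thesis by simp
qed

text \<open>Trajectories are coded, up to precision \<open>e\<close>, by a mesh on an initial interval and a list of
  points of a countable dense set; the remaining times are negligible because of the discount.\<close>

lemma countable_U_net:
  assumes e: "0 < e"
  obtains Z where "countable Z" "Z \<subseteq> trajectories" "\<And>\<omega>. \<omega> \<in> trajectories \<Longrightarrow> \<exists>z\<in>Z. U \<omega> z \<le> e"
proof -
  obtain T where T: "0 < T" "\<And>t. T \<le> t \<Longrightarrow> c powr t \<le> e" using discount_tail[OF e] by blast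
  obtain D :: "'a set" where D: "countable D" "\<And>X. open X \<Longrightarrow> X \<noteq> {} \<Longrightarrow> \<exists>d \<in> D. d \<in> X"
    using countable_dense_setE by blast
  define J where "J N k = {real k * (T / N)..(1 + real k) * (T / N)}" for N k :: nat
  text \<open>The minimum makes the last interval contain the right end point \<open>T\<close>.\<close>
  have J: "\<exists>k<N. t \<in> J N k" if N0: "0 < N" and t: "0 \<le> t" "t \<le> T" for N t
  proof -
    define k where "k = min (nat \<lfloor>t * N / T\<rfloor>) (N - 1)"
    have kN: "k < N" using N0 by (auto simp: k_def)
    have fl: "real (nat \<lfloor>t * N / T\<rfloor>) \<le> t * N / T" "t * N / T < real (nat \<lfloor>t * N / T\<rfloor>) + 1"
      using t T by (auto simp: of_nat_nat)
    have l: "k * (T / N) \<le> t"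
    proof -
      have "real k \<le> t * N / T" using fl(1) by (simp add: k_def)
      then show ?thesis using T N0 by (simp add: field_simps)
    qed
    have r: "t \<le> (1 + real k) * (T / N)"
    proof (cases "nat \<lfloor>t * N / T\<rfloor> \<le> N - 1")
      case True
      then have "t * N / T < real k + 1" using fl(2) by (simp add: k_def)
      then show ?thesis using T N0 by (simp add: field_simps)
    next
      case False
      then have "1 + real k = N" using N0 by (simp add: k_def of_nat_diff)
      then have "(1 + real k) * (T / N) = T" using N0 by simp
      then show ?thesis using t by simp
    qed
    show ?thesis using kN l r by (auto simp: J_def)
  qed
  \<comment> \<open>Two trajectories in one cell are at most \<open>e\<close> apart before time
    \<open>T\<close>. A list of points need not be followed by any trajectory, so the net consists
    of representatives chosen from the non-empty cells.\<close>
  define cell where "cell = (\<lambda>(N, as). {\<omega> \<in> trajectories. 0 < N \<and>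
      (\<forall>k<N. \<forall>s\<in>J N k. m (\<omega> s) (as ! k) \<le> e / 2)})"
  define Z where "Z = (\<lambda>i. SOME \<omega>. \<omega> \<in> cell i) ` {i \<in> UNIV \<times> lists D. cell i \<noteq> {}}"
  show thesis
  proof (rule that[of Z])
    show "countable Z"
      unfolding Z_def by (intro countable_image countable_Collect countable_SIGMA) (auto intro: countable_lists D)
    show "Z \<subseteq> trajectories"
    proof
      fix z assume "z \<in> Z"
      then obtain i where "z = (SOME \<omega>. \<omega> \<in> cell i)" "cell i \<noteq> {}" unfolding Z_def by auto
      then have "z \<in> cell i" by (metis some_in_eq)
      then show "z \<in> trajectories" unfolding cell_def by (auto split: prod.splits)
    qed
    fix \<omega> :: "real \<Rightarrow> 'a" assume \<omega>: "\<omega> \<in> trajectories"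
    \<comment> \<open>Uniform continuity is applied to this real function of two times, which
      vanishes on the diagonal, because continuity of \<open>m\<close> gives no uniform comparison
      with the metric of the state space.\<close>
    have "continuous_on ({0..T} \<times> {0..T}) (\<lambda>p. m (\<omega> (fst p)) (\<omega> (snd p)))"
      by (intro continuous_on_m continuous_on_compose2[OF trajectory_continuous[OF \<omega>]] continuous_intros) auto
    then have "uniformly_continuous_on ({0..T} \<times> {0..T}) (\<lambda>p. m (\<omega> (fst p)) (\<omega> (snd p)))"
      by (rule compact_uniformly_continuous) (auto intro: compact_Times)
    then obtain d where d: "0 < d" "\<And>p q. p \<in> {0..T} \<times> {0..T} \<Longrightarrow> q \<in> {0..T} \<times> {0..T} \<Longrightarrow> dist q p < d \<Longrightarrow>
        dist (m (\<omega> (fst q)) (\<omega> (snd q))) (m (\<omega> (fst p)) (\<omega> (snd p))) < e / 4"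
      using e unfolding uniformly_continuous_on_def by (metis zero_less_divide_iff zero_less_numeral)
    have osc: "m (\<omega> s) (\<omega> t) < e / 4" if "s \<in> {0..T}" "t \<in> {0..T}" "\<bar>s - t\<bar> < d" for s t
      using d(2)[of "(t, t)" "(s, t)"] that by (auto simp: dist_Pair_Pair dist_real_def refl)
    obtain N :: nat where N: "T / d < N" using reals_Archimedean2 by blast
    then have N0: "0 < N" using T d by (cases N) (auto simp: field_simps)
    have mesh: "T / N < d" using N N0 d by (simp add: field_simps)
    have "\<exists>a\<in>D. m (\<omega> (k * (T / N))) a < e / 4" for k :: nat
    proof -
      have "open {y. m (\<omega> (k * (T / N))) y < e / 4}"
        by (intro open_Collect_less continuous_on_m continuous_intros)
      moreover have "\<omega> (k * (T / N)) \<in> {y. m (\<omega> (k * (T / N))) y < e / 4}" using e by (simp add: refl)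
      ultimately show ?thesis using D(2) by blast
    qed
    then obtain a where a: "\<And>k::nat. a k \<in> D" "\<And>k. m (\<omega> (k * (T / N))) (a k) < e / 4" by metis
    define i where "i = (N, map a [0..<N])"
    have "m (\<omega> s) (a k) \<le> e / 2" if k: "k < N" and s: "s \<in> J N k" for k s
    proof -
      have "1 + real k \<le> N" using k by linarith
      then have "(1 + real k) * (T / N) \<le> N * (T / N)" using T by (intro mult_right_mono) auto
      then have kT: "(1 + real k) * (T / N) \<le> T" using N0 by simp
      have 0: "0 \<le> k * (T / N)" "0 \<le> T / N" using T by simp_all
      have s': "real k * (T / N) \<le> s" "s \<le> T / N + real k * (T / N)"
        using s by (simp_all only: J_def atLeastAtMost_iff distrib_right mult_1)
      then have "\<bar>s - k * (T / N)\<bar> < d" using mesh by linarith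
      moreover have "s \<in> {0..T}" "k * (T / N) \<in> {0..T}"
        using s' kT 0 unfolding atLeastAtMost_iff distrib_right mult_1 by linarith+
      ultimately have "m (\<omega> s) (\<omega> (k * (T / N))) < e / 4"
        by (intro osc)
      then show ?thesis using a(2)[of k] tri[of "\<omega> s" "a k" "\<omega> (k * (T / N))"] by linarith
    qed
    then have \<omega>i: "\<omega> \<in> cell i" using N0 \<omega> by (simp add: i_def cell_def)
    define z where "z = (SOME \<omega>. \<omega> \<in> cell i)"
    have "i \<in> UNIV \<times> lists D" using a by (auto simp: i_def)
    then have "z \<in> Z" unfolding Z_def z_def using \<omega>i by blast
    moreover have "U \<omega> z \<le> e"
    proof (rule U_le_tail)
      have z: "z \<in> cell i" unfolding z_def using \<omega>i by (rule someI[of "\<lambda>\<omega>. \<omega> \<in> cell i"])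
      fix t assume "0 \<le> t" "t \<le> T"
      then obtain k where k: "k < N" "t \<in> J N k" using J[OF N0] by blast
      have "m (\<omega> t) (map a [0..<N] ! k) \<le> e / 2" "m (z t) (map a [0..<N] ! k) \<le> e / 2"
        using \<omega>i z k unfolding cell_def i_def by blast+
      then show "m (\<omega> t) (z t) \<le> e"
        using tri[of "\<omega> t" "z t" "map a [0..<N] ! k"] sym[of "z t"] by (smt (verit) field_sum_of_halves)
    qed (use e T in auto)
    ultimately show "\<exists>z\<in>Z. U \<omega> z \<le> e" by blast
  qed
qed

end

section \<open>Continuity for the uniform topology and partitions of unity on trajectories\<close>

lemma sum_prod_telescope:
  fixes \<psi> :: "nat \<Rightarrow> real"
  shows "(\<Sum>k<N. \<psi> k * (\<Prod>l<k. 1 - \<psi> l)) + (\<Prod>l<N. 1 - \<psi> l) = 1"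
  by (induction N) (simp_all add: algebra_simps)

locale bounded_metric =
  fixes \<Delta> :: "'a::topological_space \<Rightarrow> 'a \<Rightarrow> real"
  assumes metric_space: "Metric_space UNIV \<Delta>"
    and topology: "Metric_space.mtopology UNIV \<Delta> = euclidean"
    and bound: "\<Delta> x y \<le> 1"
begin

lemma unif_dist_upper: "0 \<le> t \<Longrightarrow> \<Delta> (\<omega> t) (\<omega>' t) \<le> unif_dist \<Delta> \<omega> \<omega>'"
  unfolding unif_dist_def by (rule cSUP_upper) (auto intro!: bdd_aboveI2[where M = 1] bound)

lemma open_contains_ball:
  assumes "open S" "x \<in> S" obtains r where "0 < r" "\<And>y. \<Delta> x y < r \<Longrightarrow> y \<in> S"
proof -
  interpret D: Metric_space UNIV \<Delta> by (rule metric_space)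
  have "openin D.mtopology S" using assms(1) topology by simp
  then obtain r where "r > 0" "D.mball x r \<subseteq> S" using assms(2) D.openin_mtopology by blast
  then show thesis by (intro that[of r]) (auto simp: D.in_mball subset_iff)
qed

lemma open_ball: "open {y. \<Delta> x y < r}"
proof -
  interpret D: Metric_space UNIV \<Delta> by (rule metric_space)
  have "open (D.mball x r)" using D.openin_mball[of x r] topology by simp
  moreover have "D.mball x r = {y. \<Delta> x y < r}" by (auto simp: D.in_mball)
  ultimately show ?thesis by simp
qed

end

locale discounted_metric = discounted_pseudometric m c + bounded_metric \<Delta>
  for m \<Delta> :: "'a::polish_space \<Rightarrow> 'a \<Rightarrow> real" and c :: real
begin

text \<open>\<open>m\<close> need not be uniformly continuous for \<Delta>, but up to the tail of
  the discount only the compact image of an initial time interval matters. A finite subcover of it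
  gives a uniform radius, as for a Lebesgue number; the factor 2 in the radii leaves room for the
  step from \<omega> to the nearby trajectory.\<close>

lemma U_small_if_uniformly_close:
  assumes \<omega>: "\<omega> \<in> trajectories" and e: "0 < e"
  obtains r where "0 < r" "\<And>\<omega>'. unif_dist \<Delta> \<omega> \<omega>' < r \<Longrightarrow> U \<omega> \<omega>' \<le> e"
proof -
  interpret D: Metric_space UNIV \<Delta> by (rule metric_space)
  obtain T where T: "0 < T" "\<And>t. T \<le> t \<Longrightarrow> c powr t \<le> e" using discount_tail[OF e] by blast
  define K where "K = \<omega> ` {0..T}"
  have "compact K"
    unfolding K_def using trajectory_continuous[OF \<omega>]
    by (intro compact_continuous_image) (auto intro: continuous_on_subset)
  have "\<exists>r>0. \<forall>y. \<Delta> x y < 2 * r \<longrightarrow> m x y < e / 2" for x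
  proof -
    have "open {y. m x y < e / 2}" by (intro open_Collect_less continuous_on_m continuous_intros)
    then obtain r where "0 < r" "\<And>y. \<Delta> x y < r \<Longrightarrow> y \<in> {y. m x y < e / 2}"
      by (rule open_contains_ball[of _ x]) (use e in \<open>auto simp: refl\<close>)
    then show ?thesis by (intro exI[of _ "r / 2"]) auto
  qed
  then obtain r where r: "\<And>x. 0 < r x" "\<And>x y. \<Delta> x y < 2 * r x \<Longrightarrow> m x y < e / 2" by metis
  have "K \<subseteq> (\<Union>x\<in>K. {y. \<Delta> x y < r x})" using r(1) by force
  then obtain C where C: "C \<subseteq> K" "finite C" "K \<subseteq> (\<Union>x\<in>C. {y. \<Delta> x y < r x})"
    using compactE_image[OF \<open>compact K\<close>, of K "\<lambda>x. {y. \<Delta> x y < r x}"] open_ball by metis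
  have "C \<noteq> {}" using C(3) T by (auto simp: K_def)
  define d where "d = Min (r ` C)"
  have d: "0 < d" "\<And>x. x \<in> C \<Longrightarrow> d \<le> r x"
    unfolding d_def using C(2) \<open>C \<noteq> {}\<close> r(1) by auto
  show thesis
  proof (rule that[OF d(1)])
    fix \<omega>' assume close: "unif_dist \<Delta> \<omega> \<omega>' < d"
    show "U \<omega> \<omega>' \<le> e"
    proof (rule U_le_tail)
      fix t assume t: "0 \<le> t" "t \<le> T"
      then have "\<omega> t \<in> K" by (simp add: K_def)
      then obtain x where x: "x \<in> C" "\<Delta> x (\<omega> t) < r x" using C(3) by blast
      have "\<Delta> (\<omega> t) (\<omega>' t) < r x"
        using unif_dist_upper[OF t(1), of \<omega> \<omega>'] close d(2)[OF x(1)] by linarith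
      then have "\<Delta> x (\<omega>' t) < 2 * r x" using D.triangle[of x "\<omega> t" "\<omega>' t"] x by simp
      then have "m x (\<omega>' t) < e / 2" by (rule r(2))
      moreover have "m x (\<omega> t) < e / 2" using x(2) r(1)[of x] by (intro r(2)) simp
      ultimately show "m (\<omega> t) (\<omega>' t) \<le> e"
        using tri[of "\<omega> t" "\<omega>' t" x] sym[of x "\<omega> t"] by linarith
    qed (use e T in auto)
  qed
qed

lemma continuous_map_U: "continuous_map (traj_topology \<Delta>) euclideanreal (\<lambda>\<omega>. U \<omega> z)"
proof -
  interpret T: Metric_space trajectories "unif_dist \<Delta>"
    by (rule Metric_space_trajectories[OF metric_space bound])
  show ?thesis
    unfolding traj_topology_def continuous_map_def
  proof (intro conjI allI impI)
    fix V :: "real set" assume "openin euclideanreal V"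
    then have V: "open V" by simp
    show "openin T.mtopology {\<omega> \<in> topspace T.mtopology. U \<omega> z \<in> V}"
      unfolding T.openin_mtopology T.topspace_mtopology
    proof (intro conjI allI impI)
      fix \<omega> assume "\<omega> \<in> {\<omega> \<in> trajectories. U \<omega> z \<in> V}"
      then have \<omega>: "\<omega> \<in> trajectories" "U \<omega> z \<in> V" by auto
      obtain e where e: "0 < e" "\<And>y. dist y (U \<omega> z) < e \<Longrightarrow> y \<in> V"
        using V \<omega>(2) unfolding open_dist by blast
      obtain r where r: "0 < r" "\<And>\<omega>'. unif_dist \<Delta> \<omega> \<omega>' < r \<Longrightarrow> U \<omega> \<omega>' \<le> e / 2"
        using U_small_if_uniformly_close[OF \<omega>(1), of "e / 2"] e by auto
      have "U \<omega>' z \<in> V" if "unif_dist \<Delta> \<omega> \<omega>' < r" for \<omega>'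
        using r(2)[OF that] U_diff[of \<omega> z \<omega>'] e(1)
        by (intro e(2)) (simp add: dist_real_def)
      then show "\<exists>r>0. T.mball \<omega> r \<subseteq> {\<omega> \<in> trajectories. U \<omega> z \<in> V}"
        using r(1) by (intro exI[of _ r]) (auto simp: T.in_mball)
    qed auto
  qed auto
qed

text \<open>Enough balls of a countable net capture both laws up to a small mass. Bump functions of
  the distances to the centres are turned into a partition of unity, and the last piece takes the
  remainder with radius 1. The weighted radii are then small for both laws, which is the error term
  of the transport bound.\<close>

lemma trajectory_partition:
  assumes \<mu>: "prob_space \<mu>" "sets \<mu> = sets traj_algebra"
    and \<nu>: "prob_space \<nu>" "sets \<nu> = sets traj_algebra"
    and e: "0 < e"
  obtains N :: nat and \<phi> z b where
    "\<And>i. \<phi> i \<in> borel_measurable traj_algebra"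
    "\<And>i. continuous_map (traj_topology \<Delta>) euclideanreal (\<phi> i)"
    "\<And>i \<omega>. 0 \<le> \<phi> i \<omega>" "\<And>i \<omega>. \<phi> i \<omega> \<le> 1" "\<And>\<omega>. (\<Sum>i\<le>N. \<phi> i \<omega>) = 1"
    "\<And>i. z i \<in> trajectories" "\<And>i \<omega>. i \<le> N \<Longrightarrow> \<phi> i \<omega> \<noteq> 0 \<Longrightarrow> U \<omega> (z i) \<le> b i"
    "\<And>i. 0 \<le> b i" "\<And>i. b i \<le> 1"
    "(\<Sum>i\<le>N. b i * (\<integral>\<omega>. \<phi> i \<omega> \<partial>\<mu>)) \<le> e" "(\<Sum>i\<le>N. b i * (\<integral>\<omega>. \<phi> i \<omega> \<partial>\<nu>)) \<le> e"
proof -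
  \<comment> \<open>The bumps have radius \<open>2 * \<epsilon>\<close> and the last piece has mass
    at most \<epsilon>, in total \<open>3 * \<epsilon>\<close>. The minimum with 1 keeps the radii
    at most 1.\<close>
  define \<epsilon> where "\<epsilon> = min 1 e / 3"
  have \<epsilon>: "0 < \<epsilon>" "3 * \<epsilon> \<le> e" "2 * \<epsilon> \<le> 1" using e by (auto simp: \<epsilon>_def)
  obtain Z where Z: "countable Z" "Z \<subseteq> trajectories" "\<And>\<omega>. \<omega> \<in> trajectories \<Longrightarrow> \<exists>z\<in>Z. U \<omega> z \<le> \<epsilon>"
    using countable_U_net[OF \<epsilon>(1)] by blast
  have sp\<mu>: "space \<mu> = trajectories" using sets_eq_imp_space_eq[OF \<mu>(2)] space_traj_algebra by simp
  have "trajectories \<noteq> ({} :: (real \<Rightarrow> 'a) set)" using prob_space.not_empty[OF \<mu>(1)] sp\<mu> by simp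
  then have "Z \<noteq> {}" using Z(3) by blast
  define z where "z = from_nat_into Z"
  have z: "z i \<in> trajectories" for i
    using from_nat_into[OF \<open>Z \<noteq> {}\<close>] Z(2) unfolding z_def by blast
  have zZ: "\<exists>k. U \<omega> (z k) \<le> \<epsilon>" if \<omega>: "\<omega> \<in> trajectories" for \<omega>
    using Z(3)[OF \<omega>] from_nat_into_surj[OF Z(1)] unfolding z_def by metis
  define A where "A n = {\<omega> \<in> trajectories. \<exists>k\<in>{..<n}. U \<omega> (z k) \<le> \<epsilon>}" for n :: nat
  have A_sets: "A n \<in> sets traj_algebra" for n
  proof -
    note [measurable] = measurable_U_section[OF z]
    have "{\<omega> \<in> space traj_algebra. \<exists>k\<in>{..<n}. U \<omega> (z k) \<le> \<epsilon>} \<in> sets traj_algebra" by measurable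
    then show ?thesis unfolding A_def space_traj_algebra .
  qed
  have mass: "\<forall>\<^sub>F n in sequentially. 1 - \<epsilon> < measure \<rho> (A n)"
    if \<rho>: "prob_space \<rho>" "sets \<rho> = sets traj_algebra" for \<rho>
  proof -
    interpret \<rho>: prob_space \<rho> by fact
    have "(\<lambda>n. measure \<rho> (A n)) \<longlonglongrightarrow> measure \<rho> (\<Union>n. A n)"
      by (rule \<rho>.finite_Lim_measure_incseq)
        (use A_sets \<rho>(2) in \<open>auto simp: incseq_def A_def intro: less_le_trans\<close>)
    moreover have "(\<Union>n. A n) = space \<rho>"
    proof -
      have "\<omega> \<in> (\<Union>n. A n)" if \<omega>: "\<omega> \<in> trajectories" for \<omega>
      proof -
        obtain k where "U \<omega> (z k) \<le> \<epsilon>" using zZ[OF \<omega>] by blast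
        then have "\<omega> \<in> A (Suc k)" using \<omega> by (auto simp: A_def)
        then show ?thesis by blast
      qed
      moreover have "A n \<subseteq> trajectories" for n by (auto simp: A_def)
      ultimately show ?thesis
        unfolding sets_eq_imp_space_eq[OF \<rho>(2)] space_traj_algebra by blast
    qed
    ultimately have "(\<lambda>n. measure \<rho> (A n)) \<longlonglongrightarrow> 1" by (simp add: \<rho>.prob_space)
    then show ?thesis using \<epsilon> by (intro order_tendstoD) auto
  qed
  obtain N where N: "1 - \<epsilon> < measure \<mu> (A N)" "1 - \<epsilon> < measure \<nu> (A N)"
    using eventually_conj[OF mass[OF \<mu>] mass[OF \<nu>]] eventually_sequentially by auto
  \<comment> \<open>Equal to 1 within distance \<epsilon> of \<open>z k\<close> and to 0 from
    distance \<open>2 * \<epsilon>\<close> on.\<close>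
  define \<psi> where "\<psi> k \<omega> = min 1 (max 0 (2 - U \<omega> (z k) * (1 / \<epsilon>)))" for k \<omega>
  \<comment> \<open>Stick breaking: piece \<open>k\<close> takes the fraction
    \<open>\<psi> k\<close> of what its predecessors left over, and piece \<open>N\<close> takes all
    the rest. On \<open>A N\<close> some bump equals 1, so nothing is left for piece
    \<open>N\<close>.\<close>
  define \<phi> where "\<phi> k \<omega> = (if k < N then \<psi> k \<omega> else 1) * (\<Prod>l<k. 1 - \<psi> l \<omega>)" for k \<omega>
  define b where "b k = (if k < N then 2 * \<epsilon> else 1)" for k
  have \<psi>01: "0 \<le> \<psi> k \<omega>" "\<psi> k \<omega> \<le> 1" for k \<omega> by (auto simp: \<psi>_def)
  have \<phi>01: "0 \<le> \<phi> k \<omega>" "\<phi> k \<omega> \<le> 1" for k \<omega>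
  proof -
    have "0 \<le> (\<Prod>l<k. 1 - \<psi> l \<omega>)" "(\<Prod>l<k. 1 - \<psi> l \<omega>) \<le> 1"
      using \<psi>01 by (auto intro!: prod_nonneg prod_le_1)
    then show "0 \<le> \<phi> k \<omega>" "\<phi> k \<omega> \<le> 1" using \<psi>01 by (auto simp: \<phi>_def intro!: mult_le_one)
  qed
  have \<phi>_sum: "(\<Sum>i\<le>N. \<phi> i \<omega>) = 1" for \<omega>
  proof -
    have "(\<Sum>i\<le>N. \<phi> i \<omega>) = (\<Sum>i<N. \<phi> i \<omega>) + \<phi> N \<omega>" by (simp add: lessThan_Suc_atMost[symmetric])
    then show ?thesis using sum_prod_telescope[of "\<lambda>k. \<psi> k \<omega>" N] by (simp add: \<phi>_def)
  qed
  have \<phi>_meas: "\<phi> k \<in> borel_measurable traj_algebra" for k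
  proof -
    note [measurable] = measurable_U_section[OF z]
    have [measurable]: "\<psi> l \<in> borel_measurable traj_algebra" for l unfolding \<psi>_def by measurable
    show ?thesis unfolding \<phi>_def by measurable
  qed
  have err: "(\<Sum>i\<le>N. b i * (\<integral>\<omega>. \<phi> i \<omega> \<partial>\<rho>)) \<le> e"
    if \<rho>: "prob_space \<rho>" "sets \<rho> = sets traj_algebra" and N: "1 - \<epsilon> < measure \<rho> (A N)" for \<rho>
  proof -
    interpret \<rho>: prob_space \<rho> by fact
    have sp: "space \<rho> = trajectories" using sets_eq_imp_space_eq[OF \<rho>(2)] space_traj_algebra by simp
    have \<phi>m: "\<phi> i \<in> borel_measurable \<rho>" for i
      using \<phi>_meas measurable_cong_sets[OF \<rho>(2) HOL.refl] by blast
    have int: "integrable \<rho> (\<phi> i)" for i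
      by (rule integrable_unit_bounded[OF _ \<phi>m \<phi>01]) unfold_locales
    have "(\<integral>\<omega>. \<phi> N \<omega> \<partial>\<rho>) \<le> (\<integral>\<omega>. indicator (space \<rho> - A N) \<omega> \<partial>\<rho>)"
    proof (rule integral_mono[OF int])
      show "integrable \<rho> (indicator (space \<rho> - A N) :: _ \<Rightarrow> real)"
        using A_sets[of N] \<rho>(2)
        by (intro integrable_real_indicator) (auto simp: less_top[symmetric])
      fix \<omega> assume \<omega>: "\<omega> \<in> space \<rho>"
      show "\<phi> N \<omega> \<le> indicator (space \<rho> - A N) \<omega>"
      proof (cases "\<omega> \<in> A N")
        case True
        then obtain k where k: "k < N" "U \<omega> (z k) \<le> \<epsilon>" by (auto simp: A_def)
        then have "U \<omega> (z k) * (1 / \<epsilon>) \<le> 1" using \<epsilon> by simp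
        then have "\<psi> k \<omega> = 1" by (simp add: \<psi>_def)
        then have "(\<Prod>l<N. 1 - \<psi> l \<omega>) = 0" using k by (intro prod_zero) auto
        then have "\<phi> N \<omega> = 0" unfolding \<phi>_def by (simp only: mult_zero_right)
        then show ?thesis by simp
      qed (use \<omega> \<phi>01 in simp)
    qed
    also have "\<dots> = 1 - measure \<rho> (A N)"
      using A_sets \<rho>(2) \<rho>.prob_compl[of "A N"] by (simp add: Int_absorb2)
    finally have last: "(\<integral>\<omega>. \<phi> N \<omega> \<partial>\<rho>) \<le> \<epsilon>" using N by simp
    have nn: "0 \<le> (\<integral>\<omega>. \<phi> i \<omega> \<partial>\<rho>)" for i using \<phi>01 by (intro integral_nonneg_AE AE_I2)
    have "(\<Sum>i\<le>N. \<integral>\<omega>. \<phi> i \<omega> \<partial>\<rho>) = (\<integral>\<omega>. (\<Sum>i\<le>N. \<phi> i \<omega>) \<partial>\<rho>)"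
      using int by (simp add: Bochner_Integration.integral_sum)
    then have tot: "(\<Sum>i\<le>N. \<integral>\<omega>. \<phi> i \<omega> \<partial>\<rho>) = 1" by (simp add: \<phi>_sum \<rho>.prob_space)
    have "(\<Sum>i\<le>N. b i * (\<integral>\<omega>. \<phi> i \<omega> \<partial>\<rho>)) = (\<Sum>i<N. 2 * \<epsilon> * (\<integral>\<omega>. \<phi> i \<omega> \<partial>\<rho>)) + (\<integral>\<omega>. \<phi> N \<omega> \<partial>\<rho>)"
      by (simp add: lessThan_Suc_atMost[symmetric] b_def)
    also have "(\<Sum>i<N. 2 * \<epsilon> * (\<integral>\<omega>. \<phi> i \<omega> \<partial>\<rho>)) = 2 * \<epsilon> * (\<Sum>i<N. \<integral>\<omega>. \<phi> i \<omega> \<partial>\<rho>)"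
      by (simp add: sum_distrib_left)
    also have "\<dots> \<le> 2 * \<epsilon> * 1"
      using tot nn[of N] \<epsilon> by (intro mult_left_mono) (auto simp: lessThan_Suc_atMost[symmetric])
    finally show ?thesis using last \<epsilon> by simp
  qed
  show thesis
  proof (rule that[of \<phi> N z b])
    show "continuous_map (traj_topology \<Delta>) euclideanreal (\<phi> k)" for k
    proof -
      have \<psi>: "continuous_map (traj_topology \<Delta>) euclideanreal (\<psi> l)" for l
        unfolding \<psi>_def
        by (intro continuous_map_real_min continuous_map_real_max continuous_map_diff
            continuous_map_real_mult_right continuous_map_U) simp_all
      show ?thesis
        unfolding \<phi>_def
        by (cases "k < N") (auto intro!: continuous_map_real_mult continuous_map_prod continuous_map_diff \<psi>)
    qed
    show "U \<omega> (z i) \<le> b i" if "i \<le> N" "\<phi> i \<omega> \<noteq> 0" for i \<omega>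
    proof (cases "i < N")
      case True
      then have "\<psi> i \<omega> \<noteq> 0" using that by (auto simp: \<phi>_def)
      then have "U \<omega> (z i) * (1 / \<epsilon>) < 2" by (auto simp: \<psi>_def max_def min_def split: if_splits)
      then show ?thesis using \<epsilon> True by (simp add: b_def field_simps)
    qed (use U_le1 in \<open>simp add: b_def\<close>)
  qed (use \<phi>_meas \<phi>01 \<phi>_sum z \<epsilon> err[OF \<mu> N(1)] err[OF \<nu> N(2)] in \<open>auto simp: b_def\<close>)
qed

end


section \<open>Formulas and laws\<close>

primrec srank :: "state_form \<Rightarrow> nat" and trank :: "traj_form \<Rightarrow> nat" where
  "srank (SConst q) = 0"
| "srank SObs = 0"
| "srank (SNeg f) = srank f"
| "srank (SInt g) = Suc (trank g)"
| "trank (TEval f t) = srank f"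
| "trank (TMin g h) = max (trank g) (trank h)"
| "trank (TMax g h) = max (trank g) (trank h)"
| "trank (TMinus g q) = trank g"
| "trank (TPlus g q) = trank g"

lemma unit_rat_range: "0 \<le> real_of_rat (Rep_unit_rat q)" "real_of_rat (Rep_unit_rat q) \<le> 1"
  using Rep_unit_rat[of q] by (simp_all add: zero_le_of_rat_iff of_rat_le_1_iff)

lemma unit_rat_dense:
  assumes a: "0 \<le> a" "a \<le> 1" and e: "0 < e"
  obtains q where "\<bar>real_of_rat (Rep_unit_rat q) - a\<bar> < e"
proof (cases "a < 1")
  case True
  then have "a < min 1 (a + e)" using e by simp
  then obtain r :: rat where r: "a < of_rat r" "of_rat r < min 1 (a + e)" using of_rat_dense by blast
  have "0 < (of_rat r :: real)" using r(1) a(1) by (rule le_less_trans[rotated])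
  moreover have "(of_rat r :: real) < 1" using r(2) by linarith
  ultimately have "0 < r" "r < 1" using zero_less_of_rat_iff of_rat_less_1_iff by blast+
  then have "r \<in> {0..1}" by (simp add: less_imp_le)
  then show thesis using r by (intro that[of "Abs_unit_rat r"]) (simp add: Abs_unit_rat_inverse)
next
  case False
  then show thesis using a e by (intro that[of "Abs_unit_rat 1"]) (simp add: Abs_unit_rat_inverse)
qed

lemma time_rat_range: "0 \<le> real_of_rat (Rep_time_rat t)"
  using Rep_time_rat[of t] by (simp add: zero_le_of_rat_iff)

text \<open>A pseudometric changes by at most the sum of the distances by which its two arguments
  move, so continuity on the diagonal implies joint continuity.\<close>

lemma continuous_on_pseudometric:
  fixes m :: "'a::t2_space \<Rightarrow> 'a \<Rightarrow> real"
  assumes refl: "\<And>x. m x x = 0" and sym: "\<And>x y. m x y = m y x"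
    and tri: "\<And>x y z. m x z \<le> m x y + m y z"
    and cont: "\<And>x. isCont (m x) x"
  shows "continuous_on UNIV (\<lambda>p. m (fst p) (snd p))"
  unfolding continuous_on_eq_continuous_at[OF open_UNIV]
proof (intro ballI)
  fix p :: "'a \<times> 'a"
  have lim: "((\<lambda>q. m (fst p) (fst q) + m (snd p) (snd q)) \<longlongrightarrow> m (fst p) (fst p) + m (snd p) (snd p)) (at p)"
    by (intro tendsto_add isCont_tendsto_compose[OF cont] tendsto_fst tendsto_snd tendsto_ident_at)
  have "((\<lambda>q. m (fst q) (snd q) - m (fst p) (snd p)) \<longlongrightarrow> 0) (at p)"
  proof (rule Lim_null_comparison[OF always_eventually])
    show "\<forall>q. norm (m (fst q) (snd q) - m (fst p) (snd p)) \<le> m (fst p) (fst q) + m (snd p) (snd q)"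
    proof
      fix q
      show "norm (m (fst q) (snd q) - m (fst p) (snd p)) \<le> m (fst p) (fst q) + m (snd p) (snd q)"
        using tri[of "fst q" "snd q" "fst p"] tri[of "fst p" "snd q" "snd p"]
          tri[of "fst p" "snd p" "fst q"] tri[of "fst q" "snd p" "snd q"]
          sym[of "fst p" "fst q"] sym[of "snd p" "snd q"]
        by (simp add: abs_le_iff)
    qed
    show "((\<lambda>q. m (fst p) (fst q) + m (snd p) (snd q)) \<longlongrightarrow> 0) (at p)"
      using lim by (simp add: refl)
  qed
  then show "isCont (\<lambda>p. m (fst p) (snd p)) p"
    unfolding isCont_def by (simp only: LIM_zero_iff)
qed

section \<open>Range of formulas, finite lattice operations, and the initial state of the
  paths\<close>

locale discounted_diffusion = diffusion Phat \<Delta> P Law obs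
  for Phat :: "real \<Rightarrow> ('a::polish_space, real) bcontfun \<Rightarrow> ('a, real) bcontfun"
    and \<Delta> P Law obs +
  fixes c :: real
  assumes c_pos: "0 < c" and c_less_1: "c < 1"
begin

sublocale bounded_metric \<Delta>
  by (rule bounded_metric.intro[OF metric metric_topology metric_le_1])

abbreviation "S \<equiv> state_sem Law obs c"
abbreviation "T \<equiv> traj_sem Law obs c"
abbreviation "d \<equiv> d_seq Law obs c"

lemma Law_prob: "prob_space (Law x)" and Law_sets: "sets (Law x) = sets traj_algebra"
  using Law_in_prob_algebra[of x] by (auto simp: space_prob_algebra)

lemma Law_measurable: "h \<in> borel_measurable (Law x) \<longleftrightarrow> h \<in> borel_measurable traj_algebra"
  using measurable_cong_sets[OF Law_sets HOL.refl] by blast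

lemma disc_le_1: "0 \<le> t \<Longrightarrow> c powr t \<le> 1"
  using powr_mono'[of 0 t c] c_pos c_less_1 by simp

lemma state_sem_range: "0 \<le> S f x \<and> S f x \<le> 1"
  and traj_sem_range: "0 \<le> T g \<omega> \<and> T g \<omega> \<le> 1"
proof (induction f and g arbitrary: x and \<omega>)
  case (SObs x)
  then show ?case using obs_range[of x] by simp
next
  case (SInt g x)
  interpret prob_space "Law x" by (rule Law_prob)
  show ?case
  \<comment> \<open>A non-integrable function has integral 0, so the range can be settled for all
    formulas here, before measurability is known; that comes level by level.\<close>
  proof (cases "integrable (Law x) (T g)")
    case True
    then have "(\<integral>\<omega>. T g \<omega> \<partial>Law x) \<le> 1" using SInt by (intro integral_le_const) auto
    moreover have "0 \<le> (\<integral>\<omega>. T g \<omega> \<partial>Law x)" using SInt by (intro integral_nonneg_AE) auto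
    ultimately show ?thesis by simp
  qed (simp add: not_integrable_integral_eq)
next
  case (TEval f t \<omega>)
  then show ?case using disc_le_1[OF time_rat_range[of t]] by (auto intro!: mult_le_one)
next
  case (TMinus g q \<omega>)
  then have "T g \<omega> \<le> 1" by simp
  then show ?case using unit_rat_range(1)[of q] unfolding traj_sem.simps by linarith
next
  case (TPlus g q \<omega>)
  then show ?case using unit_rat_range(1)[of q] by (simp add: min_def)
next
  case (TMin g1 g2 \<omega>)
  then show ?case by (simp add: min_def)
next
  case (TMax g1 g2 \<omega>)
  then show ?case by (simp add: max_def)
qed (use unit_rat_range in auto)

lemma finite_TMin:
  fixes N :: nat
  assumes "\<And>j. j \<le> N \<Longrightarrow> trank (gs j) \<le> k"
  obtains g where "trank g \<le> k" "\<And>j \<omega>. j \<le> N \<Longrightarrow> T g \<omega> \<le> T (gs j) \<omega>"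
    "\<And>\<omega>. \<exists>j\<le>N. T g \<omega> = T (gs j) \<omega>"
proof -
  have "\<exists>g. trank g \<le> k \<and> (\<forall>j\<le>N. \<forall>\<omega>. T g \<omega> \<le> T (gs j) \<omega>) \<and> (\<forall>\<omega>. \<exists>j\<le>N. T g \<omega> = T (gs j) \<omega>)"
    using assms
  proof (induction N)
    case (Suc N)
    then obtain g where g: "trank g \<le> k" "\<forall>j\<le>N. \<forall>\<omega>. T g \<omega> \<le> T (gs j) \<omega>"
      "\<forall>\<omega>. \<exists>j\<le>N. T g \<omega> = T (gs j) \<omega>" by fastforce
    show ?case
    proof (intro exI[of _ "TMin g (gs (Suc N))"] conjI allI impI)
      show "T (TMin g (gs (Suc N))) \<omega> \<le> T (gs j) \<omega>" if "j \<le> Suc N" for j \<omega>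
        using g(2) that by (auto simp: le_Suc_eq min.coboundedI1)
      show "\<exists>j\<le>Suc N. T (TMin g (gs (Suc N))) \<omega> = T (gs j) \<omega>" for \<omega>
        using g(3) by (cases "T g \<omega> \<le> T (gs (Suc N)) \<omega>") (auto simp: min_def intro: le_SucI)
    qed (use g Suc.prems in auto)
  qed (auto intro!: exI[of _ "gs 0"])
  then show thesis using that by blast
qed

lemma finite_TMax:
  fixes N :: nat
  assumes "\<And>j. j \<le> N \<Longrightarrow> trank (gs j) \<le> k"
  obtains g where "trank g \<le> k" "\<And>j \<omega>. j \<le> N \<Longrightarrow> T (gs j) \<omega> \<le> T g \<omega>"
    "\<And>\<omega>. \<exists>j\<le>N. T g \<omega> = T (gs j) \<omega>"
proof -
  have "\<exists>g. trank g \<le> k \<and> (\<forall>j\<le>N. \<forall>\<omega>. T (gs j) \<omega> \<le> T g \<omega>) \<and> (\<forall>\<omega>. \<exists>j\<le>N. T g \<omega> = T (gs j) \<omega>)"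
    using assms
  proof (induction N)
    case (Suc N)
    then obtain g where g: "trank g \<le> k" "\<forall>j\<le>N. \<forall>\<omega>. T (gs j) \<omega> \<le> T g \<omega>"
      "\<forall>\<omega>. \<exists>j\<le>N. T g \<omega> = T (gs j) \<omega>" by fastforce
    show ?case
    proof (intro exI[of _ "TMax g (gs (Suc N))"] conjI allI impI)
      show "T (gs j) \<omega> \<le> T (TMax g (gs (Suc N))) \<omega>" if "j \<le> Suc N" for j \<omega>
        using g(2) that by (auto simp: le_Suc_eq max.coboundedI1)
      show "\<exists>j\<le>Suc N. T (TMax g (gs (Suc N))) \<omega> = T (gs j) \<omega>" for \<omega>
        using g(3) by (cases "T g \<omega> \<le> T (gs (Suc N)) \<omega>") (auto simp: max_def intro: le_SucI)
    qed (use g Suc.prems in auto)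
  qed (auto intro!: exI[of _ "gs 0"])
  then show thesis using that by blast
qed

text \<open>\<open>Phat 0\<close> is the identity on \<open>C0\<close>, and local compactness
  supplies functions in \<open>C0\<close> that peak at \<open>x\<close> and vanish off an
  arbitrarily small ball. Their value 1 at \<open>x\<close> forces each such ball to carry full
  mass, and the balls shrink to the point.\<close>

lemma kernel_zero: "emeasure (P 0 x) {x} = 1"
proof -
  have PA: "P 0 x \<in> space (prob_algebra borel)"
    using markov_kernel[of 0] by (auto intro: measurable_space)
  have sets: "sets (P 0 x) = sets borel" using PA by (simp add: space_prob_algebra)
  interpret prob_space "P 0 x" using PA by (simp add: space_prob_algebra)
  obtain W K where WK: "open W" "compact K" "x \<in> W" "W \<subseteq> K"
    using locally_compact unfolding locally_compact_space_def
    by (metis UNIV_I compactin_euclidean_iff open_openin topspace_euclidean)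
  obtain r0 where r0: "0 < r0" "ball x r0 \<subseteq> W" using WK openE by blast
  have ball: "measure (P 0 x) (ball x r) = 1" if r: "0 < r" "r \<le> r0" for r
  proof -
    \<comment> \<open>A tent of height 1 at \<open>x\<close> that lies below the indicator of the
      ball of radius \<open>r\<close>. As \<open>r \<le> r0\<close>, it vanishes outside the compact
      set \<open>K\<close>.\<close>
    define f where "f = Bcontfun (\<lambda>y. max 0 (1 - dist x y / r))"
    have bc: "(\<lambda>y. max 0 (1 - dist x y / r)) \<in> bcontfun"
      using r by (intro bcontfun_normI[where b = 1] continuous_intros) (auto simp: divide_le_eq)
    have f: "apply_bcontfun f y = max 0 (1 - dist x y / r)" for y
      unfolding f_def by (simp add: Bcontfun_inverse[OF bc])
    have "f \<in> C0"
      unfolding C0_def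
    proof (intro CollectI allI impI exI[of _ K] conjI WK(2))
      fix e :: real and y assume e: "0 < e" and "y \<notin> K"
      then have "y \<notin> ball x r0" using r0(2) WK(4) by blast
      then have "r \<le> dist x y" using r by simp
      then show "\<bar>apply_bcontfun f y\<bar> < e" using r e by (simp add: f)
    qed
    then have "apply_bcontfun f x = (\<integral>y. apply_bcontfun f y \<partial>P 0 x)"
      using kernel_represents[of 0 f x] identity[of f] by simp
    then have "1 = (\<integral>y. apply_bcontfun f y \<partial>P 0 x)" by (simp add: f)
    also have "\<dots> \<le> (\<integral>y. indicator (ball x r) y \<partial>P 0 x)"
    proof (rule integral_mono)
      have "apply_bcontfun f \<in> borel_measurable (P 0 x)"
        using borel_measurable_continuous_onI[of "apply_bcontfun f"] measurable_cong_sets[OF sets HOL.refl]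
          continuous_on_apply_bcontfun by blast
      then show "integrable (P 0 x) (apply_bcontfun f)"
        using r by (intro integrable_const_bound[where B = 1]) (auto simp: f)
      show "integrable (P 0 x) (indicator (ball x r) :: _ \<Rightarrow> real)"
        by (intro integrable_real_indicator) (auto simp: sets less_top[symmetric])
      show "apply_bcontfun f y \<le> indicator (ball x r) y" for y
        using r by (auto simp: f field_simps split: split_indicator)
    qed
    also have "\<dots> = measure (P 0 x) (ball x r)"
      using sets_eq_imp_space_eq[OF sets] by simp
    finally show ?thesis using prob_le_1[of "ball x r"] by linarith
  qed
  have "decseq (\<lambda>n. ball x (r0 / Suc n))"
    unfolding decseq_def using r0 by (intro allI impI subset_ball divide_left_mono) simp_all
  then have "(\<lambda>n. measure (P 0 x) (ball x (r0 / Suc n))) \<longlonglongrightarrow> measure (P 0 x) (\<Inter>n. ball x (r0 / Suc n))"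
    by (intro finite_Lim_measure_decseq) (simp_all add: sets image_subset_iff)
  moreover have "(\<Inter>n. ball x (r0 / Suc n)) = {x}"
  proof -
    have "y = x" if y: "\<And>n::nat. dist x y < r0 / Suc n" for y
    proof (rule ccontr)
      assume "y \<noteq> x"
      then have "0 < dist x y / r0" using r0 by simp
      then obtain n where "inverse (Suc n) < dist x y / r0" using reals_Archimedean by blast
      then show False using y[of n] r0 by (simp add: field_simps)
    qed
    then show ?thesis using r0 by auto
  qed
  moreover have "measure (P 0 x) (ball x (r0 / Suc n)) = 1" for n :: nat
  proof (rule ball)
    show "0 < r0 / Suc n" using r0 by simp
    have "r0 * 1 \<le> r0 * Suc n" using r0 by (intro mult_left_mono) auto
    then show "r0 / Suc n \<le> r0" by (simp add: divide_le_eq)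
  qed
  ultimately have "measure (P 0 x) {x} = 1" by (simp add: LIMSEQ_const_iff)
  then show "emeasure (P 0 x) {x} = 1" by (simp add: emeasure_eq_measure)
qed

lemma Law_start: "AE \<omega> in Law x. \<omega> 0 = x"
proof -
  interpret prob_space "Law x" by (rule Law_prob)
  have "emeasure (Law x) {\<omega> \<in> trajectories. \<omega> 0 = x} = path_prob P 0 x [(0, {x})]"
    using Law_finite_dim[of "[(0, {x})]" x] by simp
  also have "\<dots> = (\<integral>\<^sup>+y\<in>{x}. 1 \<partial>P 0 x)" by simp
  also have "\<dots> = emeasure (P 0 x) {x}"
  proof -
    have "sets (P 0 x) = sets borel"
      using measurable_space[OF markov_kernel[of 0], of x] by (simp add: space_prob_algebra)
    then show ?thesis by (simp add: nn_integral_indicator)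
  qed
  finally have 1: "emeasure (Law x) {\<omega> \<in> trajectories. \<omega> 0 = x} = 1"
    by (simp add: kernel_zero)
  \<comment> \<open>A set that is not measurable would have \<open>emeasure\<close> 0.\<close>
  then have meas: "{\<omega> \<in> trajectories. \<omega> 0 = x} \<in> sets (Law x)"
    using emeasure_notin_sets by fastforce
  have "prob {\<omega> \<in> trajectories. \<omega> 0 = x} = 1" using 1 by (simp add: measure_def)
  from AE_in_set_eq_1[OF meas, THEN iffD2, OF this] show ?thesis by auto
qed

end

section \<open>Duality and its consequences at a fixed level\<close>

lemma couplings_nonempty:
  assumes \<mu>: "prob_space \<mu>" and \<nu>: "prob_space \<nu>" and sets: "sets \<nu> = sets \<mu>"
  shows "couplings \<mu> \<nu> \<noteq> {}"
proof -
  interpret \<mu>: prob_space \<mu> by fact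
  interpret \<nu>: prob_space \<nu> by fact
  \<comment> \<open>The product coupling, written as the spread-out plan of the partition of unity
    with a single piece.\<close>
  have "density (\<mu> \<Otimes>\<^sub>M \<nu>) (\<lambda>p. ennreal (\<Sum>i\<in>{()}. \<Sum>j\<in>{()}. 1 / (1 * 1) * (1 * 1))) \<in> couplings \<mu> \<nu>"
    by (rule spread_plan[OF \<mu> \<nu> sets, of "{()}" "\<lambda>_ _. 1" "\<lambda>_. 1" "\<lambda>_. 1" "\<lambda>_ _. 1"])
      (auto simp: \<mu>.prob_space \<nu>.prob_space)
  then show ?thesis by blast
qed

text \<open>As a locale, the induction hypothesis makes all facts about \<open>U\<close> available
  for \<open>d n\<close>. Its last assumption is oriented, without an absolute value, because
  interpolation asks for a formula that is larger at a prescribed one of two points.\<close>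

locale diffusion_level = discounted_diffusion Phat \<Delta> P Law obs c
  for Phat :: "real \<Rightarrow> ('a::polish_space, real) bcontfun \<Rightarrow> ('a, real) bcontfun"
    and \<Delta> P Law obs c +
  fixes n :: nat
  assumes level_pseudometric: "discounted_pseudometric (d n) c"
    and level_nonexpansive: "srank f \<le> n \<Longrightarrow> \<bar>S f x - S f y\<bar> \<le> d n x y"
    and level_attained: "0 < e \<Longrightarrow> \<exists>f. srank f \<le> n \<and> d n x y - e < S f x - S f y"
begin

sublocale discounted_metric "d n" \<Delta> c
  by (rule discounted_metric.intro[OF level_pseudometric bounded_metric_axioms])

lemma continuous_state_sem:
  assumes "srank f \<le> n" shows "continuous_on UNIV (S f)"
  unfolding continuous_on_eq_continuous_at[OF open_UNIV]
proof
  fix x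
  have "continuous_on UNIV (d n x)" by (intro continuous_on_m continuous_intros)
  then have "(d n x \<longlongrightarrow> d n x x) (at x)"
    unfolding continuous_on_eq_continuous_at[OF open_UNIV] isCont_def by blast
  then have "(d n x \<longlongrightarrow> 0) (at x)" by (simp add: refl)
  then have "((\<lambda>y. S f y - S f x) \<longlongrightarrow> 0) (at x)"
    by (rule Lim_null_comparison[OF always_eventually, rotated])
      (use level_nonexpansive[OF assms] in \<open>auto simp: sym[of x]\<close>)
  then show "isCont (S f) x" unfolding isCont_def by (simp only: LIM_zero_iff)
qed

text \<open>State formulas enter only through their continuity, which the rank bound guarantees;
  hence the trivial predicate for the state half of the mutual induction.\<close>

lemma measurable_traj_sem: "trank g \<le> n \<Longrightarrow> T g \<in> borel_measurable traj_algebra"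
proof (induction g rule: traj_form.induct[of "\<lambda>_. True"])
  case (TEval f t)
  then have "continuous_on UNIV (S f)" by (intro continuous_state_sem) simp
  from measurable_compose[OF measurable_eval[OF time_rat_range[of t]] borel_measurable_continuous_onI[OF this]]
  show ?case by simp
qed simp_all

lemma traj_sem_nonexpansive: "trank g \<le> n \<Longrightarrow> \<bar>T g \<omega> - T g \<omega>'\<bar> \<le> U \<omega> \<omega>'"
proof (induction g rule: traj_form.induct[of "\<lambda>_. True"])
  case (TEval f t)
  let ?t = "real_of_rat (Rep_time_rat t)"
  have "\<bar>T (TEval f t) \<omega> - T (TEval f t) \<omega>'\<bar> = c powr ?t * \<bar>S f (\<omega> ?t) - S f (\<omega>' ?t)\<bar>"
    by (simp add: right_diff_distrib[symmetric] abs_mult)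
  also have "\<dots> \<le> c powr ?t * d n (\<omega> ?t) (\<omega>' ?t)"
    using TEval by (intro mult_left_mono level_nonexpansive) auto
  also have "\<dots> \<le> U \<omega> \<omega>'" by (rule U_upper[OF time_rat_range])
  finally show ?case .
next
  case (TMin g h)
  then have "\<bar>T g \<omega> - T g \<omega>'\<bar> \<le> U \<omega> \<omega>'" "\<bar>T h \<omega> - T h \<omega>'\<bar> \<le> U \<omega> \<omega>'" by auto
  then show ?case unfolding traj_sem.simps by linarith
next
  case (TMax g h)
  then have "\<bar>T g \<omega> - T g \<omega>'\<bar> \<le> U \<omega> \<omega>'" "\<bar>T h \<omega> - T h \<omega>'\<bar> \<le> U \<omega> \<omega>'" by auto
  then show ?case unfolding traj_sem.simps by linarith
next
  case (TMinus g q)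
  then have "\<bar>T g \<omega> - T g \<omega>'\<bar> \<le> U \<omega> \<omega>'" by auto
  then show ?case unfolding traj_sem.simps by linarith
next
  case (TPlus g q)
  then have "\<bar>T g \<omega> - T g \<omega>'\<bar> \<le> U \<omega> \<omega>'" by auto
  then show ?case unfolding traj_sem.simps by linarith
qed simp_all

lemma integrable_traj_sem: "trank g \<le> n \<Longrightarrow> integrable (Law x) (T g)"
  by (rule integrable_unit_bounded[where B = 1])
    (use traj_sem_range Law_measurable[THEN iffD2, OF measurable_traj_sem] Law_prob in
      \<open>simp_all add: prob_space.finite_measure\<close>)

lemma Law_integral_nonexpansive:
  assumes g: "trank g \<le> n"
  shows "\<bar>(\<integral>\<omega>. T g \<omega> \<partial>Law x) - (\<integral>\<omega>. T g \<omega> \<partial>Law y)\<bar> \<le> d (Suc n) x y"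
proof -
  have "\<bar>(\<integral>\<omega>. T g \<omega> \<partial>Law x) - (\<integral>\<omega>. T g \<omega> \<partial>Law y)\<bar> \<le> (\<integral>p. U (fst p) (snd p) \<partial>\<gamma>)"
    if \<gamma>: "\<gamma> \<in> couplings (Law x) (Law y)" for \<gamma>
  proof -
    interpret \<gamma>: prob_space \<gamma> by (rule couplings_prob_space[OF \<gamma> Law_prob])
    have sets: "sets \<gamma> = sets (traj_algebra \<Otimes>\<^sub>M traj_algebra)"
      using couplingsD(1)[OF \<gamma>] sets_pair_measure_cong[OF Law_sets Law_sets] by simp
    note meas = measurable_cong_sets[OF sets HOL.refl, THEN equalityD2, THEN subsetD]
    have intU: "integrable \<gamma> (\<lambda>p. U (fst p) (snd p))"
      by (rule integrable_unit_bounded[where B = 1])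
        (auto intro: meas measurable_U U_nonneg U_le1 \<gamma>.finite_measure_axioms)
    have int: "integrable \<gamma> (\<lambda>p. T g (fst p))" "integrable \<gamma> (\<lambda>p. T g (snd p))"
      using traj_sem_range measurable_compose[OF measurable_fst measurable_traj_sem[OF g]]
        measurable_compose[OF measurable_snd measurable_traj_sem[OF g]]
      by (auto intro!: integrable_unit_bounded[where B = 1] meas \<gamma>.finite_measure_axioms)
    have Tm: "T g \<in> borel_measurable (Law z)" for z
      using Law_measurable measurable_traj_sem[OF g] by blast
    have "(\<integral>\<omega>. T g \<omega> \<partial>Law x) - (\<integral>\<omega>. T g \<omega> \<partial>Law y) = (\<integral>p. T g (fst p) - T g (snd p) \<partial>\<gamma>)"
      using couplings_integral_marginals[OF \<gamma>, of "T g"] Tm int by simp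
    also have "\<bar>\<dots>\<bar> \<le> (\<integral>p. \<bar>T g (fst p) - T g (snd p)\<bar> \<partial>\<gamma>)" by (rule integral_abs_bound)
    also have "\<dots> \<le> (\<integral>p. U (fst p) (snd p) \<partial>\<gamma>)"
      using int intU traj_sem_nonexpansive[OF g] by (intro integral_mono) auto
    finally show ?thesis .
  qed
  then show ?thesis
    \<comment> \<open>A lower bound passes to an infimum of reals only over a non-empty set, so a
      coupling has to be exhibited.\<close>
    unfolding d_seq.simps G_op_def transport_cost_def
    using couplings_nonempty[OF Law_prob Law_prob, of y x] Law_sets
    by (intro cINF_greatest) auto
qed

text \<open>A rational time and a formula are chosen at which the discounted difference nearly
  realises \<open>U \<omega> \<omega>'\<close>. Shifting down by the value at \<omega>' and then up
  by \<open>b\<close> places the two values. Only one-sided bounds are claimed, as the difference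
  may well exceed \<open>a - b\<close>.\<close>

lemma two_point_approximation:
  assumes \<omega>: "\<omega> \<in> trajectories" "\<omega>' \<in> trajectories"
    and a: "0 \<le> a" "a \<le> 1" and b: "0 \<le> b" "b \<le> 1" and ab: "a - b \<le> U \<omega> \<omega>'" and e: "0 < e"
  obtains g where "trank g \<le> n" "a - e \<le> T g \<omega>" "T g \<omega>' \<le> b + e"
proof -
  obtain s :: rat where s: "0 \<le> s"
    "U \<omega> \<omega>' - e / 4 < c powr of_rat s * d n (\<omega> (of_rat s)) (\<omega>' (of_rat s))"
    using U_rational_witness[OF \<omega>, of "U \<omega> \<omega>' - e / 4"] e by auto
  define t where "t = Abs_time_rat s"
  have t: "Rep_time_rat t = s" using s by (simp add: t_def Abs_time_rat_inverse)
  obtain f where f: "srank f \<le> n"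
    "d n (\<omega> (of_rat s)) (\<omega>' (of_rat s)) - e / 4 < S f (\<omega> (of_rat s)) - S f (\<omega>' (of_rat s))"
    using level_attained[of "e / 4"] e by fastforce
  define p where "p = T (TEval f t) \<omega>"
  define r where "r = T (TEval f t) \<omega>'"
  have r01: "0 \<le> r" "r \<le> 1" using traj_sem_range by (simp_all only: r_def)
  have "c powr of_rat s \<le> 1" using s by (intro powr_le1) simp
  then have "c powr of_rat s * (e / 4) \<le> e / 4" using e by (simp add: mult_left_le_one_le)
  moreover have "c powr of_rat s * (d n (\<omega> (of_rat s)) (\<omega>' (of_rat s)) - e / 4) \<le> p - r"
    unfolding p_def r_def traj_sem.simps t right_diff_distrib[symmetric]
    using f(2) by (intro mult_left_mono) auto
  ultimately have pr: "a - b - e / 2 \<le> p - r"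
    using s(2) ab unfolding right_diff_distrib by linarith
  obtain q where q: "\<bar>real_of_rat (Rep_unit_rat q) - r\<bar> < e / 8"
    using unit_rat_dense[OF r01, of "e / 8"] e by auto
  obtain q' where q': "\<bar>real_of_rat (Rep_unit_rat q') - b\<bar> < e / 8"
    using unit_rat_dense[OF b, of "e / 8"] e by auto
  show thesis
  \<comment> \<open>The truncations do no harm: the one at 0 only raises the value at \<omega>, the
    one at 1 matters only above \<open>a \<le> 1\<close>. Time and formula cost \<open>e / 4\<close>
    each, the two rational shifts \<open>e / 8\<close> each.\<close>
  proof (rule that[of "TPlus (TMinus (TEval f t) q) q'"])
    show "a - e \<le> T (TPlus (TMinus (TEval f t) q) q') \<omega>"
      unfolding traj_sem.simps(4,5) p_def[symmetric] using pr q q' a e by linarith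
    show "T (TPlus (TMinus (TEval f t) q) q') \<omega>' \<le> b + e"
      unfolding traj_sem.simps(4,5) r_def[symmetric] using pr q q' b e by linarith
  qed (use f in simp)
qed

text \<open>The lattice argument of the Stone-Weierstrass theorem. The minimum over \<open>j\<close>
  of the two-point formulas stays high at \<open>z i\<close> and is nowhere too high on the centres;
  the maximum over \<open>i\<close> of these minima is then also high enough at every
  centre.\<close>

lemma finite_interpolation:
  fixes N :: nat
  assumes z: "\<And>i. z i \<in> trajectories"
    and h: "\<And>i. i \<le> N \<Longrightarrow> 0 \<le> h i" "\<And>i. i \<le> N \<Longrightarrow> h i \<le> 1"
    and lip: "\<And>i j. i \<le> N \<Longrightarrow> j \<le> N \<Longrightarrow> \<bar>h i - h j\<bar> \<le> U (z i) (z j)" and e: "0 < e"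
  obtains g where "trank g \<le> n" "\<And>i. i \<le> N \<Longrightarrow> \<bar>T g (z i) - h i\<bar> \<le> e"
proof -
  have "\<exists>g. trank g \<le> n \<and> h i - e \<le> T g (z i) \<and> T g (z j) \<le> h j + e" if "i \<le> N" "j \<le> N" for i j
    using two_point_approximation[OF z[of i] z[of j] h(1)[OF that(1)] h(2)[OF that(1)]
        h(1)[OF that(2)] h(2)[OF that(2)] _ e] lip[OF that]
    by (metis abs_ge_self order_trans)
  then obtain G where G: "\<And>i j. i \<le> N \<Longrightarrow> j \<le> N \<Longrightarrow> trank (G i j) \<le> n"
    "\<And>i j. i \<le> N \<Longrightarrow> j \<le> N \<Longrightarrow> h i - e \<le> T (G i j) (z i)"
    "\<And>i j. i \<le> N \<Longrightarrow> j \<le> N \<Longrightarrow> T (G i j) (z j) \<le> h j + e" by metis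
  have "\<exists>g. trank g \<le> n \<and> h i - e \<le> T g (z i) \<and> (\<forall>j\<le>N. T g (z j) \<le> h j + e)" if i: "i \<le> N" for i
  proof -
    obtain g where g: "trank g \<le> n" "\<And>j \<omega>. j \<le> N \<Longrightarrow> T g \<omega> \<le> T (G i j) \<omega>"
      "\<And>\<omega>. \<exists>j\<le>N. T g \<omega> = T (G i j) \<omega>"
      using finite_TMin[of N "G i" n] G(1)[OF i] by blast
    show ?thesis
      using g(1) g(2)[THEN order_trans, OF _ G(3)[OF i]] g(3)[of "z i"] G(2)[OF i] by auto
  qed
  then obtain H where H: "\<And>i. i \<le> N \<Longrightarrow> trank (H i) \<le> n" "\<And>i. i \<le> N \<Longrightarrow> h i - e \<le> T (H i) (z i)"
    "\<And>i j. i \<le> N \<Longrightarrow> j \<le> N \<Longrightarrow> T (H i) (z j) \<le> h j + e" by metis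
  obtain g where g: "trank g \<le> n" "\<And>j \<omega>. j \<le> N \<Longrightarrow> T (H j) \<omega> \<le> T g \<omega>"
    "\<And>\<omega>. \<exists>j\<le>N. T g \<omega> = T (H j) \<omega>"
    using finite_TMax[of N H n] H(1) by blast
  show thesis
  proof (rule that[OF g(1)])
    fix i assume i: "i \<le> N"
    obtain j where j: "j \<le> N" "T g (z i) = T (H j) (z i)" using g(3) by blast
    show "\<bar>T g (z i) - h i\<bar> \<le> e"
      using H(2)[OF i] g(2)[OF i, of "z i"] H(3)[OF j(1) i] j(2) by linarith
  qed
qed

lemma Law_pair_measurable_U:
  "(\<lambda>p. U (fst p) (snd p)) \<in> borel_measurable (Law x \<Otimes>\<^sub>M Law y)"
  using measurable_U measurable_cong_sets[OF sets_pair_measure_cong[OF Law_sets Law_sets] HOL.refl] by blast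

lemma next_level_attained:
  assumes e: "0 < e"
  obtains g where "trank g \<le> n" "d (Suc n) x y - e < (\<integral>\<omega>. T g \<omega> \<partial>Law x) - (\<integral>\<omega>. T g \<omega> \<partial>Law y)"
proof -
  \<comment> \<open>The transport bound loses \<open>3 * \<eta>\<close>, namely the radii under both
    laws and the duality error, and replacing the potential by a formula loses
    \<open>2 * \<eta>\<close> for each law; together \<open>7 * \<eta> < e\<close>.\<close>
  define \<eta> where "\<eta> = e / 8"
  have \<eta>: "0 < \<eta>" using e by (simp add: \<eta>_def)
  show thesis
  proof (rule trajectory_partition[OF Law_prob[of x] Law_sets[of x] Law_prob[of y] Law_sets[of y] \<eta>])
    fix N :: nat and \<phi> z b
    assume \<phi>_meas: "\<And>i. \<phi> i \<in> borel_measurable traj_algebra"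
      and \<phi>: "\<And>i \<omega>. 0 \<le> \<phi> i \<omega>" "\<And>i \<omega>. \<phi> i \<omega> \<le> 1" and \<phi>_sum: "\<And>\<omega>. (\<Sum>i\<le>N. \<phi> i \<omega>) = 1"
      and z: "\<And>i. z i \<in> trajectories" and b: "\<And>i \<omega>. i \<le> N \<Longrightarrow> \<phi> i \<omega> \<noteq> 0 \<Longrightarrow> U \<omega> (z i) \<le> b i"
      and errx: "(\<Sum>i\<le>N. b i * (\<integral>\<omega>. \<phi> i \<omega> \<partial>Law x)) \<le> \<eta>"
      and erry: "(\<Sum>i\<le>N. b i * (\<integral>\<omega>. \<phi> i \<omega> \<partial>Law y)) \<le> \<eta>"
    have \<phi>m: "\<phi> i \<in> borel_measurable (Law w)" for i w using Law_measurable \<phi>_meas by blast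
    show thesis
    proof (rule transport_cost_le_partition[of "Law x" "Law y" U "{..N}" \<phi> z b
          "\<lambda>i. \<integral>\<omega>. \<phi> i \<omega> \<partial>Law x" "\<lambda>i. \<integral>\<omega>. \<phi> i \<omega> \<partial>Law y" \<eta>])
      fix h
      assume h: "\<And>i j. i \<in> {..N} \<Longrightarrow> j \<in> {..N} \<Longrightarrow> \<bar>h i - h j\<bar> \<le> U (z i) (z j)"
        "\<And>i. i \<in> {..N} \<Longrightarrow> 0 \<le> h i" "\<And>i. i \<in> {..N} \<Longrightarrow> h i \<le> 1"
        and cost: "transport_cost U (Law x) (Law y) \<le>
          (\<Sum>i\<le>N. h i * ((\<integral>\<omega>. \<phi> i \<omega> \<partial>Law x) - (\<integral>\<omega>. \<phi> i \<omega> \<partial>Law y))) +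
          (\<Sum>i\<le>N. b i * ((\<integral>\<omega>. \<phi> i \<omega> \<partial>Law x) + (\<integral>\<omega>. \<phi> i \<omega> \<partial>Law y))) + \<eta>"
      obtain g where g: "trank g \<le> n" "\<And>i. i \<le> N \<Longrightarrow> \<bar>T g (z i) - h i\<bar> \<le> \<eta>"
        using finite_interpolation[of z N h \<eta>] z h \<eta> by (metis atMost_iff)
      \<comment> \<open>Where \<open>\<phi> i\<close> does not vanish, \<open>T g\<close> differs
        from \<open>h i\<close> by at most \<open>b i\<close> for the move to the centre and \<eta>
        for the interpolation there.\<close>
      have close: "\<bar>(\<integral>\<omega>. T g \<omega> \<partial>Law w) - (\<Sum>i\<le>N. h i * (\<integral>\<omega>. \<phi> i \<omega> \<partial>Law w))\<bar> \<le> 2 * \<eta>"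
        if bw: "(\<Sum>i\<le>N. b i * (\<integral>\<omega>. \<phi> i \<omega> \<partial>Law w)) \<le> \<eta>" for w
      proof -
        interpret prob_space "Law w" by (rule Law_prob)
        have int\<phi>: "integrable (Law w) (\<phi> i)" for i
          using \<phi> by (intro integrable_unit_bounded[OF _ \<phi>m]) unfold_locales
        have pt: "\<bar>T g \<omega> - (\<Sum>i\<le>N. h i * \<phi> i \<omega>)\<bar> \<le> (\<Sum>i\<le>N. (b i + \<eta>) * \<phi> i \<omega>)" for \<omega>
        proof -
          have "T g \<omega> - (\<Sum>i\<le>N. h i * \<phi> i \<omega>) = (\<Sum>i\<le>N. (T g \<omega> - h i) * \<phi> i \<omega>)"
            using \<phi>_sum[of \<omega>] by (simp add: left_diff_distrib sum_subtractf sum_distrib_left[symmetric])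
          also have "\<bar>\<dots>\<bar> \<le> (\<Sum>i\<le>N. \<bar>(T g \<omega> - h i) * \<phi> i \<omega>\<bar>)" by (rule sum_abs)
          also have "\<dots> \<le> (\<Sum>i\<le>N. (b i + \<eta>) * \<phi> i \<omega>)"
          proof (rule sum_mono)
            fix i assume i: "i \<in> {..N}"
            show "\<bar>(T g \<omega> - h i) * \<phi> i \<omega>\<bar> \<le> (b i + \<eta>) * \<phi> i \<omega>"
            proof (cases "\<phi> i \<omega> = 0")
              case False
              have "\<bar>T g \<omega> - h i\<bar> \<le> b i + \<eta>"
                using b[of i \<omega>] False i g(2)[of i] traj_sem_nonexpansive[OF g(1), of \<omega> "z i"] by simp
              then show ?thesis using \<phi>(1)[of i \<omega>] by (simp add: abs_mult mult_right_mono)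
            qed simp
          qed
          finally show ?thesis .
        qed
        have "(\<integral>\<omega>. T g \<omega> \<partial>Law w) - (\<Sum>i\<le>N. h i * (\<integral>\<omega>. \<phi> i \<omega> \<partial>Law w)) =
            (\<integral>\<omega>. T g \<omega> - (\<Sum>i\<le>N. h i * \<phi> i \<omega>) \<partial>Law w)"
          using int\<phi> integrable_traj_sem[OF g(1)]
          by (simp add: Bochner_Integration.integral_sum Bochner_Integration.integrable_sum)
        also have "\<bar>\<dots>\<bar> \<le> (\<integral>\<omega>. \<bar>T g \<omega> - (\<Sum>i\<le>N. h i * \<phi> i \<omega>)\<bar> \<partial>Law w)"
          by (rule integral_abs_bound)
        also have "\<dots> \<le> (\<integral>\<omega>. (\<Sum>i\<le>N. (b i + \<eta>) * \<phi> i \<omega>) \<partial>Law w)"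
          using int\<phi> integrable_traj_sem[OF g(1)] pt
          by (intro integral_mono integrable_abs Bochner_Integration.integrable_diff
              Bochner_Integration.integrable_sum integrable_mult_right) auto
        also have "\<dots> = (\<Sum>i\<le>N. b i * (\<integral>\<omega>. \<phi> i \<omega> \<partial>Law w)) + \<eta> * (\<Sum>i\<le>N. \<integral>\<omega>. \<phi> i \<omega> \<partial>Law w)"
          using int\<phi> by (simp add: Bochner_Integration.integral_sum distrib_right sum.distrib sum_distrib_left)
        also have "(\<Sum>i\<le>N. \<integral>\<omega>. \<phi> i \<omega> \<partial>Law w) = (\<integral>\<omega>. (\<Sum>i\<le>N. \<phi> i \<omega>) \<partial>Law w)"
          using int\<phi> by (simp add: Bochner_Integration.integral_sum)
        finally show ?thesis using bw by (simp add: \<phi>_sum prob_space)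
      qed
      show thesis
      proof (rule that[OF g(1)])
        have "d (Suc n) x y \<le> (\<Sum>i\<le>N. h i * (\<integral>\<omega>. \<phi> i \<omega> \<partial>Law x)) - (\<Sum>i\<le>N. h i * (\<integral>\<omega>. \<phi> i \<omega> \<partial>Law y)) + 3 * \<eta>"
          using cost errx erry
          by (simp add: G_op_def right_diff_distrib distrib_left sum_subtractf sum.distrib)
        then show "d (Suc n) x y - e < (\<integral>\<omega>. T g \<omega> \<partial>Law x) - (\<integral>\<omega>. T g \<omega> \<partial>Law y)"
          using close[OF errx] close[OF erry] e unfolding \<eta>_def by linarith
      qed
    qed ((rule Law_prob Law_pair_measurable_U U_refl U_sym U_tri U_nonneg U_le1 \<phi>m \<phi>(1) \<phi>_sum
          HOL.refl \<eta> finite_atMost | simp add: Law_sets b)+)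
  qed
qed

end

section \<open>From one level to the next\<close>

context diffusion_level
begin

text \<open>For one fixed partition the transport bound involves \<open>y\<close> only through
  finitely many masses, which weak continuity controls.\<close>

lemma next_level_isCont: "isCont (d (Suc n) x) x" if refl0: "d (Suc n) x x = 0" and nn: "\<And>y. 0 \<le> d (Suc n) x y"
  unfolding isCont_def refl0
proof (rule order_tendstoI)
  show "\<forall>\<^sub>F y in at x. a < d (Suc n) x y" if "a < 0" for a
    using nn that by (intro always_eventually allI less_le_trans[OF that]) 
next
  fix e :: real assume e: "0 < e"
  define \<eta> where "\<eta> = e / 8"
  have \<eta>: "0 < \<eta>" using e by (simp add: \<eta>_def)
  show "\<forall>\<^sub>F y in at x. d (Suc n) x y < e"
  \<comment> \<open>Both laws are \<open>Law x\<close>, since the partition must not depend on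
    \<open>y\<close>. That the weighted radii are small under \<open>Law y\<close> as well follows
    from the closeness of the masses.\<close>
  proof (rule trajectory_partition[OF Law_prob[of x] Law_sets[of x] Law_prob[of x] Law_sets[of x] \<eta>])
    fix N :: nat and \<phi> z b
    assume \<phi>_meas: "\<And>i. \<phi> i \<in> borel_measurable traj_algebra"
      and \<phi>_cont: "\<And>i. continuous_map (traj_topology \<Delta>) euclideanreal (\<phi> i)"
      and \<phi>: "\<And>i \<omega>. 0 \<le> \<phi> i \<omega>" "\<And>i \<omega>. \<phi> i \<omega> \<le> 1" and \<phi>_sum: "\<And>\<omega>. (\<Sum>i\<le>N. \<phi> i \<omega>) = 1"
      and b: "\<And>i \<omega>. i \<le> N \<Longrightarrow> \<phi> i \<omega> \<noteq> 0 \<Longrightarrow> U \<omega> (z i) \<le> b i"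
      and b01: "\<And>i. 0 \<le> b i" "\<And>i. b i \<le> 1"
      and bx: "(\<Sum>i\<le>N. b i * (\<integral>\<omega>. \<phi> i \<omega> \<partial>Law x)) \<le> \<eta>"
    have \<phi>m: "\<phi> i \<in> borel_measurable (Law w)" for i w using Law_measurable \<phi>_meas by blast
    define M where "M i w = (\<integral>\<omega>. \<phi> i \<omega> \<partial>Law w)" for i w
    have "continuous_on UNIV (M i)" for i
      unfolding M_def using \<phi>
      by (intro Law_weakly_continuous[where B = 1] \<phi>_cont \<phi>_meas) auto
    then have "isCont (\<lambda>y. \<Sum>i\<le>N. \<bar>M i x - M i y\<bar>) x"
      by (intro continuous_intros) (auto simp: continuous_on_eq_continuous_at)
    then have "((\<lambda>y. \<Sum>i\<le>N. \<bar>M i x - M i y\<bar>) \<longlongrightarrow> 0) (at x)"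
      by (simp add: isCont_def)
    then have "\<forall>\<^sub>F y in at x. (\<Sum>i\<le>N. \<bar>M i x - M i y\<bar>) < \<eta>"
      using \<eta> by (rule order_tendstoD)
    then show "\<forall>\<^sub>F y in at x. d (Suc n) x y < e"
    proof (rule eventually_mono)
      fix y assume close: "(\<Sum>i\<le>N. \<bar>M i x - M i y\<bar>) < \<eta>"
      show "d (Suc n) x y < e"
      proof (rule transport_cost_le_partition[of "Law x" "Law y" U "{..N}" \<phi> z b
            "\<lambda>i. M i x" "\<lambda>i. M i y" \<eta>])
        fix h
        assume h: "\<And>i. i \<in> {..N} \<Longrightarrow> 0 \<le> h i" "\<And>i. i \<in> {..N} \<Longrightarrow> h i \<le> 1"
          and cost: "transport_cost U (Law x) (Law y) \<le>
            (\<Sum>i\<le>N. h i * (M i x - M i y)) + (\<Sum>i\<le>N. b i * (M i x + M i y)) + \<eta>"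
        have "(\<Sum>i\<le>N. h i * (M i x - M i y)) \<le> (\<Sum>i\<le>N. \<bar>M i x - M i y\<bar>)"
        proof (rule sum_mono)
          fix i assume i: "i \<in> {..N}"
          have "h i * (M i x - M i y) \<le> h i * \<bar>M i x - M i y\<bar>" using h(1)[OF i] by (intro mult_left_mono) auto
          also have "\<dots> \<le> 1 * \<bar>M i x - M i y\<bar>" using h(2)[OF i] by (intro mult_right_mono) auto
          finally show "h i * (M i x - M i y) \<le> \<bar>M i x - M i y\<bar>" by simp
        qed
        moreover have "(\<Sum>i\<le>N. b i * (M i x + M i y)) \<le> (\<Sum>i\<le>N. 2 * (b i * M i x) + \<bar>M i x - M i y\<bar>)"
        proof (rule sum_mono)
          fix i
          have "b i * (M i y - M i x) \<le> b i * \<bar>M i x - M i y\<bar>" using b01 by (intro mult_left_mono) auto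
          also have "\<dots> \<le> 1 * \<bar>M i x - M i y\<bar>" using b01 by (intro mult_right_mono) auto
          finally show "b i * (M i x + M i y) \<le> 2 * (b i * M i x) + \<bar>M i x - M i y\<bar>"
            by (simp add: algebra_simps)
        qed
        ultimately show "d (Suc n) x y < e"
          using cost bx close e
          by (simp add: G_op_def sum.distrib sum_distrib_left[symmetric] M_def[symmetric] \<eta>_def)
      qed ((rule Law_prob Law_pair_measurable_U U_refl U_sym U_tri U_nonneg U_le1 \<phi>m \<phi>(1) \<phi>_sum
            HOL.refl \<eta> finite_atMost | simp add: Law_sets b M_def fun_eq_iff)+)
    qed
  qed
qed

text \<open>By \<open>le\<close> and \<open>ge\<close>, \<open>d (Suc n) x y\<close> is the supremum
  of the differences \<open>?I g x - ?I g y\<close> over formulas of rank at most \<open>n\<close>.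
  Every axiom except continuity is immediate for such a supremum; the absolute value in
  \<open>Law_integral_nonexpansive\<close> provides the reversed orientation for symmetry.\<close>

lemma next_level_pseudometric: "discounted_pseudometric (d (Suc n)) c"
proof -
  let ?I = "\<lambda>g x. \<integral>\<omega>. T g \<omega> \<partial>Law x"
  have le: "d (Suc n) x y \<le> B" if "\<And>g. trank g \<le> n \<Longrightarrow> ?I g x - ?I g y \<le> B" for x y B
  proof (rule field_le_epsilon)
    fix e :: real assume "0 < e"
    then obtain g where "trank g \<le> n" "d (Suc n) x y - e < ?I g x - ?I g y"
      using next_level_attained by blast
    then show "d (Suc n) x y \<le> B + e" using that[of g] by linarith
  qed
  have ge: "?I g x - ?I g y \<le> d (Suc n) x y" "?I g y - ?I g x \<le> d (Suc n) x y" if "trank g \<le> n" for g x y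
    using Law_integral_nonexpansive[OF that, of x y] by (auto simp: abs_le_iff)
  have nn: "0 \<le> d (Suc n) x y" for x y
    by (rule order_trans[OF abs_ge_zero Law_integral_nonexpansive[of "TEval SObs (Abs_time_rat 0)"]]) simp
  have refl: "d (Suc n) x x = 0" for x
    using le[of x x 0] nn[of x x] by simp
  have sym: "d (Suc n) x y \<le> d (Suc n) y x" for x y
    by (rule le) (rule ge(2))
  have tri: "d (Suc n) x z \<le> d (Suc n) x y + d (Suc n) y z" for x y z
  proof (rule le)
    fix g assume "trank g \<le> n"
    from ge(1)[OF this, of x y] ge(1)[OF this, of y z]
    show "?I g x - ?I g z \<le> d (Suc n) x y + d (Suc n) y z" by linarith
  qed
  show ?thesis
  proof
    show "d (Suc n) x y \<le> 1" for x y
    proof (rule le)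
      fix g
      show "?I g x - ?I g y \<le> 1"
        using state_sem_range[of "SInt g" x] state_sem_range[of "SInt g" y] by simp
    qed
    show sym': "d (Suc n) x y = d (Suc n) y x" for x y by (intro antisym sym)
    show "continuous_on UNIV (\<lambda>p. d (Suc n) (fst p) (snd p))"
      by (rule continuous_on_pseudometric[OF refl sym' tri next_level_isCont[OF refl nn]])
  qed (rule c_pos c_less_1 refl tri nn)+
qed

lemma next_level: "diffusion_level Phat \<Delta> P Law obs c (Suc n)"
proof (intro diffusion_level.intro[OF discounted_diffusion_axioms] diffusion_level_axioms.intro)
  show pm: "discounted_pseudometric (d (Suc n)) c" by (rule next_level_pseudometric)
  show "\<bar>S f x - S f y\<bar> \<le> d (Suc n) x y" if "srank f \<le> Suc n" for f x y
    using that
  proof (induction f rule: state_form.induct[of _ "\<lambda>_. True"])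
    case (SConst q)
    then show ?case using discounted_pseudometric.nonneg[OF pm] by simp
  next
    case SObs
    define g where "g = TEval SObs (Abs_time_rat 0)"
    have g: "trank g \<le> n" by (simp add: g_def)
    have Tg: "T g \<omega> = obs (\<omega> 0)" for \<omega>
      using c_pos by (simp add: g_def Abs_time_rat_inverse)
    have obs: "(\<integral>\<omega>. T g \<omega> \<partial>Law w) = obs w" for w
    proof -
      interpret prob_space "Law w" by (rule Law_prob)
      have "(\<integral>\<omega>. T g \<omega> \<partial>Law w) = (\<integral>\<omega>. obs w \<partial>Law w)"
      proof (rule integral_cong_AE)
        show "T g \<in> borel_measurable (Law w)"
          using Law_measurable measurable_traj_sem[OF g] by blast
        show "AE \<omega> in Law w. T g \<omega> = obs w"
          using Law_start[of w] by (rule AE_mp) (simp add: Tg)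
      qed simp
      then show ?thesis by (simp add: prob_space)
    qed
    show ?case using Law_integral_nonexpansive[OF g, of x y] by (simp only: obs state_sem.simps)
  next
    case (SInt g)
    then show ?case using Law_integral_nonexpansive[of g x y] by simp
  qed simp_all
  show "\<exists>f. srank f \<le> Suc n \<and> d (Suc n) x y - e < S f x - S f y" if e: "0 < e" for e x y
  proof -
    obtain g where "trank g \<le> n" "d (Suc n) x y - e < (\<integral>\<omega>. T g \<omega> \<partial>Law x) - (\<integral>\<omega>. T g \<omega> \<partial>Law y)"
      by (rule next_level_attained[OF e])
    then show ?thesis by (intro exI[of _ "SInt g"]) simp
  qed
qed

end

section \<open>Base of the induction and conclusion\<close>

context discounted_diffusion
begin

lemma level_0: "diffusion_level Phat \<Delta> P Law obs c 0"
proof (intro diffusion_level.intro[OF discounted_diffusion_axioms] diffusion_level_axioms.intro)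
  show "discounted_pseudometric (d 0) c"
  proof
    show "d 0 x y \<le> 1" for x y using obs_range[of x] obs_range[of y] by (auto simp: abs_le_iff)
    show "continuous_on UNIV (\<lambda>p. d 0 (fst p) (snd p))"
      by (simp, intro continuous_intros continuous_on_compose2[OF obs_continuous]) auto
  qed (use c_pos c_less_1 in auto)
  show "\<bar>S f x - S f y\<bar> \<le> d 0 x y" if "srank f \<le> 0" for f x y
    using that by (induction f rule: state_form.induct[of _ "\<lambda>_. True"]) simp_all
  show "\<exists>f. srank f \<le> 0 \<and> d 0 x y - e < S f x - S f y" if "0 < e" for e x y
  proof (cases "obs y \<le> obs x")
    case True
    then show ?thesis using that by (intro exI[of _ SObs]) simp
  next
    case False
    \<comment> \<open>Negation reverses the orientation.\<close>
    then show ?thesis using that by (intro exI[of _ "SNeg SObs"]) simp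
  qed
qed

lemma level: "diffusion_level Phat \<Delta> P Law obs c n"
  by (induction n) (auto intro: level_0 diffusion_level.next_level)

lemma ell_eq_dbar: "ell Law obs c x y = dbar Law obs c x y"
proof (rule antisym)
  have "\<bar>S f x - S f y\<bar> \<le> 1" for f
    using state_sem_range[of f x] state_sem_range[of f y] by (simp add: abs_le_iff)
  then have bS: "bdd_above (range (\<lambda>f. \<bar>S f x - S f y\<bar>))" by (intro bdd_aboveI2)
  have "d n x y \<le> 1" for n
    using discounted_pseudometric.le1[OF diffusion_level.level_pseudometric[OF level]] .
  then have bd: "bdd_above (range (\<lambda>n. d n x y))" by (intro bdd_aboveI2)
  show "ell Law obs c x y \<le> dbar Law obs c x y"
    unfolding ell_def
  proof (rule cSUP_least)
    fix f
    \<comment> \<open>Each formula is compared at the level given by its own rank, so monotonicity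
      of \<open>d n\<close> in \<open>n\<close> does not enter.\<close>
    have "\<bar>S f x - S f y\<bar> \<le> d (srank f) x y"
      using diffusion_level.level_nonexpansive[OF level[of "srank f"]] by simp
    also have "\<dots> \<le> dbar Law obs c x y" unfolding dbar_def by (rule cSUP_upper[OF UNIV_I bd])
    finally show "\<bar>S f x - S f y\<bar> \<le> dbar Law obs c x y" .
  qed simp
  show "dbar Law obs c x y \<le> ell Law obs c x y"
    unfolding dbar_def
  proof (rule cSUP_least)
    fix n
    show "d n x y \<le> ell Law obs c x y"
    proof (rule field_le_epsilon)
      fix e :: real assume "0 < e"
      then obtain f where "d n x y - e < S f x - S f y"
        using diffusion_level.level_attained[OF level] by blast
      also have "\<dots> \<le> \<bar>S f x - S f y\<bar>" by simp
      also have "\<dots> \<le> ell Law obs c x y" unfolding ell_def by (rule cSUP_upper[OF UNIV_I bS])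
      finally show "d n x y \<le> ell Law obs c x y + e" by simp
    qed
  qed simp
qed

end

theorem theorem5p7:
  fixes Phat :: "real \<Rightarrow> ('a::polish_space, real) bcontfun \<Rightarrow> ('a, real) bcontfun"
    and \<Delta> :: "'a \<Rightarrow> 'a \<Rightarrow> real"
    and P :: "real \<Rightarrow> 'a \<Rightarrow> 'a measure"
    and Law :: "'a \<Rightarrow> (real \<Rightarrow> 'a) measure"
    and obs :: "'a \<Rightarrow> real"
    and c :: real
  assumes "diffusion Phat \<Delta> P Law obs"
    and "0 < c" and "c < 1"
  shows "ell Law obs c = dbar Law obs c"
proof -
  interpret discounted_diffusion Phat \<Delta> P Law obs c
    using assms by (intro discounted_diffusion.intro discounted_diffusion_axioms.intro)
  show ?thesis by (intro ext ell_eq_dbar)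
qed

end
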